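(* For every $\alpha \in (1,2)$ there is a function $f \colon [0,1] \to [0,1]$ such that: (i) the graph $\Gamma(f) \subset \mathbb{R}^2$ has Hausdorff dimension greater than $\alpha$; (ii) there is a quasisymmetric mapping $g \colon \Gamma(f) \to Y$ onto a metric space $Y$ of Hausdorff dimension $1$; (iii) there is a set $A \subset [0,1]$ of positive Lebesgue measure such that for every $a \in A$ the set $\Gamma(f) \cap (\mathbb{R} \times \{a\})$ has Hausdorff dimension $\dim_H(\Gamma(f)) - 1$.
   Context: $\Gamma(f) = \{(x,f(x)) : x \in [0,1]\} \subset \mathbb{R}^2$ denotes the graph of $f$, equipped with the Euclidean metric, and $\dim_H$ denotes Hausdorff dimension. A homeomorphism $g \colon X \to Y$ between metric spaces $(X,d_X)$ and $(Y,d_Y)$ is quasisymmetric if there exists a homeomorphism $\eta \colon [0,\infty) \to [0,\infty)$ such that for all distinct points $x,y,z \in X$, $$\frac{d_Y(g(x),g(y))}{d_Y(g(x),g(z))} \leq \eta\left(\frac{d_X(x,y)}{d_X(x,z)}\right).$$ *)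

theory Defs
  imports "HOL-Analysis.Analysis"
begin

definition mdiameter :: "'a metric \<Rightarrow> 'a set \<Rightarrow> ennreal" where
  "mdiameter m U = (SUP x\<in>U. SUP y\<in>U. ennreal (mdist m x y))"

(* diam(U)^s with the usual conventions diam({})^s = 0 and, for nonempty U, diam(U)^0 = 1
   (powr would give 0 for a singleton and s = 0).  Only sets of finite diameter are
   used below, so enn2real loses nothing. *)
definition diam_power :: "'a metric \<Rightarrow> real \<Rightarrow> 'a set \<Rightarrow> ennreal" where
  "diam_power m s U =
     (if U = {} then 0
      else if s = 0 then 1
      else ennreal (enn2real (mdiameter m U) powr s))"

definition hausdorff_premeasure :: "'a metric \<Rightarrow> real \<Rightarrow> real \<Rightarrow> 'a set \<Rightarrow> ennreal" where
  "hausdorff_premeasure m s \<delta> E =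
     Inf {(\<Sum>n. diam_power m s (U n)) | U :: nat \<Rightarrow> 'a set.
            (\<forall>n. U n \<subseteq> mspace m \<and> mdiameter m (U n) \<le> ennreal \<delta>) \<and> E \<subseteq> (\<Union>n. U n)}"

definition hausdorff_measure :: "'a metric \<Rightarrow> real \<Rightarrow> 'a set \<Rightarrow> ennreal" where
  "hausdorff_measure m s E = (SUP \<delta>\<in>{0<..}. hausdorff_premeasure m s \<delta> E)"

(* The infimum in ereal of the empty set is infinity. *)
definition hausdorff_dim :: "'a metric \<Rightarrow> 'a set \<Rightarrow> ereal" where
  "hausdorff_dim m E = Inf {ereal s | s. 0 \<le> s \<and> hausdorff_measure m s E = 0}"

(* g is a quasisymmetric homeomorphism of X onto Y; in particular g maps mspace X onto
   mspace Y bijectively, so the denominators are nonzero. *)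
definition quasisymmetric :: "'a metric \<Rightarrow> 'b metric \<Rightarrow> ('a \<Rightarrow> 'b) \<Rightarrow> bool" where
  "quasisymmetric X Y g \<longleftrightarrow>
     homeomorphic_map (mtopology_of X) (mtopology_of Y) g \<and>
     (\<exists>\<eta> :: real \<Rightarrow> real.
        homeomorphic_map (top_of_set {0..}) (top_of_set {0..}) \<eta> \<and>
        (\<forall>x\<in>mspace X. \<forall>y\<in>mspace X. \<forall>z\<in>mspace X.
           x \<noteq> y \<and> x \<noteq> z \<and> y \<noteq> z \<longrightarrow>
           mdist Y (g x) (g y) / mdist Y (g x) (g z) \<le> \<eta> (mdist X x y / mdist X x z)))"

(* The product metric on real \<times> real is the Euclidean one, so this is a subset of the
   Euclidean plane; the values of f outside [0,1] play no role. *)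
definition graph_of :: "(real \<Rightarrow> real) \<Rightarrow> (real \<times> real) set" where
  "graph_of f = {(x, f x) | x. x \<in> {0..1}}"

end

theory Submission
  imports Defs
begin

text \<open>
  The function is discontinuous. Its graph is assembled from a horizontal piece, which stays as it
  is, and a piece inside a product \<open>C \<times> F\<close>, which carries the dimension and is distorted.

  Fix a large base \<open>b\<close>. The Cantor set \<open>C\<close> (\<open>cantor\<close>) consists of the \<open>x\<close> without a base \<open>b\<close> digit
  \<open>b - 1\<close>; its dimension \<open>s\<close> (\<open>slice_dim\<close>) is the logarithm of \<open>b - 1\<close> to the base \<open>b\<close>, close to
  1 for large \<open>b\<close>, and different level-\<open>n\<close> cells of \<open>C\<close> are at least \<open>1 / b ^ (n + 1)\<close> apart. On the vertical
  axis, let the base \<open>b\<close> digits be independent and almost always equal to 1. The resulting measure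
  is doubling, but nearly all cells of level \<open>n\<close>, in the sense of Lebesgue measure, have a mass far
  below their length \<open>1 / b ^ n\<close>: there is a set \<open>F\<close> (\<open>light_heights\<close>) of positive Lebesgue
  measure in \<open>[1/2, 1)\<close>, all of whose cells of level \<open>n\<close> have mass at most \<open>1 / b ^ (2 * n)\<close>. This
  is the mechanism behind Tukia's quasisymmetric maps of the line that send a set of full measure
  to a set of small dimension.

  It extends to \<open>C \<times> F\<close>. Measure the distance of two points by the mass of a vertical interval
  around them whose length is their Euclidean distance. In the plane this would not be comparable
  to a metric, since long horizontal paths would become too cheap; but a path in \<open>C \<times> F\<close> from one
  cell of \<open>C\<close> to another must make a horizontal jump that is as long as the distance of the cells.
  The infimum of the costs of such paths with one jump is a metric (\<open>bridge_dist\<close>), and because the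
  mass is doubling, the identity is quasisymmetric: at each point and each scale both metrics see
  one size (\<open>quasisymmetric_id_by_scales\<close>). For the distorted metric, \<open>C \<times> F\<close> is covered by
  \<open>(b - 1) ^ n * b ^ n\<close> pieces of diameter \<open>2 / b ^ (2 * n)\<close>, so its dimension is at most 1. A
  function that takes values in \<open>F\<close> on a subset of \<open>C\<close> and vanishes elsewhere therefore has a graph
  that is quasisymmetric to a space of dimension 1; the lower bound comes from the segments of the
  horizontal piece, on which the metric is not changed.

  It remains to choose the function so that each level set over \<open>F\<close> has the full dimension \<open>s\<close>. A
  point of \<open>C\<close> encodes a pair \<open>(a, z)\<close>: its digits at square positions list the rational cut of \<open>a\<close>,
  the other digits list the expansion of \<open>z\<close> in base \<open>b - 1\<close>, and the function takes the value \<open>a\<close>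
  there. Squares have density zero, so \<open>z\<close> depends on the point in a Hoelder continuous way with any
  exponent \<open>t < s\<close> (\<open>parameter_hoelder\<close>). Pulling back Lebesgue measure along \<open>z\<close> bounds the dimension
  of the slice at height \<open>a\<close> from below by \<open>s\<close>, and pulling it back along \<open>(a, z)\<close> bounds the
  dimension of the graph from below by \<open>1 + s\<close> (\<open>hausdorff_measure_neq_0_by_parametrization\<close>). The
  upper bounds only count cells.
\<close>

section \<open>Hausdorff dimension from codings and parametrizations\<close>

lemma mdist_le_diameter:
  assumes "x \<in> U" "y \<in> U" "mdiameter m U < top"
  shows "mdist m x y \<le> enn2real (mdiameter m U)"
proof -
  have "ennreal (mdist m x y) \<le> mdiameter m U"
    unfolding mdiameter_def using assms(1,2) by (meson SUP_upper SUP_upper2)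
  also have "\<dots> = ennreal (enn2real (mdiameter m U))"
    using assms(3) by simp
  finally show ?thesis
    by (simp add: enn2real_nonneg)
qed

lemma mdiameter_le:
  assumes "\<And>x y. x \<in> U \<Longrightarrow> y \<in> U \<Longrightarrow> mdist m x y \<le> r"
  shows "mdiameter m U \<le> ennreal r"
  unfolding mdiameter_def using assms by (intro SUP_least ennreal_leI) auto

text \<open>
  A coding of the points by finitely many codes, such that points with the same code are close, is
  a finite covering in a form that avoids naming the covering sets.
\<close>

lemma hausdorff_measure_eq_0_by_codes:
  fixes code :: "nat \<Rightarrow> 'a \<Rightarrow> 'b" and r card_bound :: "nat \<Rightarrow> real"
  assumes t: "0 < t" and E: "E \<subseteq> mspace m"
    and fin: "\<And>n. finite (code n ` E)" and card: "\<And>n. real (card (code n ` E)) \<le> card_bound n"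
    and diam: "\<And>n x y. x \<in> E \<Longrightarrow> y \<in> E \<Longrightarrow> code n x = code n y \<Longrightarrow> mdist m x y \<le> r n"
    and r0: "\<And>n. 0 \<le> r n" and r: "r \<longlonglongrightarrow> 0"
    and lim: "(\<lambda>n. card_bound n * r n powr t) \<longlonglongrightarrow> 0"
  shows "hausdorff_measure m t E = 0"
proof -
  have "hausdorff_premeasure m t \<delta> E \<le> ennreal e" if "0 < \<delta>" "0 < e" for \<delta> e
  proof -
    have "\<forall>\<^sub>F n in sequentially. r n < \<delta> \<and> card_bound n * r n powr t < e"
      using order_tendstoD(2)[OF r \<open>0 < \<delta>\<close>] order_tendstoD(2)[OF lim \<open>0 < e\<close>]
      by eventually_elim auto
    then obtain n where n: "r n < \<delta>" "card_bound n * r n powr t < e"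
      using eventually_happens'[OF sequentially_bot] by blast
    define N where "N = card (code n ` E)"
    obtain g where g: "bij_betw g {0..<N} (code n ` E)"
      using ex_bij_betw_nat_finite[OF fin] N_def by blast
    define U where "U i = (if i < N then {x \<in> E. code n x = g i} else {})" for i
    have dist: "mdist m x y \<le> r n" if "x \<in> U i" "y \<in> U i" for i x y
      using that diam unfolding U_def by (auto split: if_splits)
    have diamU: "mdiameter m (U i) \<le> ennreal (r n)" for i
      using dist by (rule mdiameter_le)
    have pow: "diam_power m t (U i) \<le> ennreal (r n powr t)" for i
    proof -
      have "enn2real (mdiameter m (U i)) \<le> r n"
        using diamU r0 by (simp add: enn2real_leI)
      then show ?thesis
        using t unfolding diam_power_def by (auto intro!: ennreal_leI powr_mono2)
    qed
    have cover: "E \<subseteq> (\<Union>i. U i)"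
    proof
      fix x assume "x \<in> E"
      then obtain i where "i < N" "code n x = g i"
        using g by (metis atLeastLessThan_iff bij_betw_imp_surj_on image_iff)
      with \<open>x \<in> E\<close> show "x \<in> (\<Union>i. U i)"
        unfolding U_def by auto
    qed
    have "hausdorff_premeasure m t \<delta> E \<le> (\<Sum>i. diam_power m t (U i))"
      unfolding hausdorff_premeasure_def
    proof (rule Inf_lower, safe intro!: exI[of _ U])
      show "x \<in> mspace m" if "x \<in> U i" for x i
        using that E unfolding U_def by (auto split: if_splits)
      show "mdiameter m (U i) \<le> ennreal \<delta>" for i
        using diamU n(1) by (meson ennreal_leI less_imp_le order_trans)
      show "x \<in> (\<Union>i. U i)" if "x \<in> E" for x using cover that by auto
    qed
    also have "\<dots> = (\<Sum>i<N. diam_power m t (U i))"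
      by (rule suminf_finite) (auto simp: U_def diam_power_def)
    also have "\<dots> \<le> (\<Sum>i<N. ennreal (r n powr t))"
      by (intro sum_mono pow)
    also have "\<dots> = ennreal (real N * r n powr t)"
      by (simp add: ennreal_mult ennreal_of_nat_eq_real_of_nat)
    also have "\<dots> \<le> ennreal e"
    proof (rule ennreal_leI)
      have "real N * r n powr t \<le> card_bound n * r n powr t"
        using card[of n] by (intro mult_right_mono) (auto simp: N_def)
      then show "real N * r n powr t \<le> e" using n(2) by simp
    qed
    finally show ?thesis .
  qed
  note small = this
  have "hausdorff_premeasure m t \<delta> E \<le> 0" if "0 < \<delta>" for \<delta>
  proof (rule ennreal_le_epsilon)
    fix e :: real assume "0 < e"
    with small[OF that] show "hausdorff_premeasure m t \<delta> E \<le> 0 + ennreal e" by simp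
  qed
  then have "hausdorff_measure m t E \<le> 0"
    unfolding hausdorff_measure_def by (intro SUP_least) simp
  then show ?thesis by simp
qed

text \<open>
  The self-similar case: \<open>B ^ n\<close> codes for pieces of diameter \<open>1 / D ^ n\<close>, up to constants.
\<close>

lemma hausdorff_measure_eq_0_by_geometric_codes:
  fixes code :: "nat \<Rightarrow> 'a \<Rightarrow> 'b" and A B C D t :: real
  assumes t: "0 < t" and E: "E \<subseteq> mspace m"
    and AC: "0 \<le> A" "0 \<le> C" and B: "0 \<le> B" "B < D powr t" and D: "1 < D"
    and fin: "\<And>n. finite (code n ` E)" and card: "\<And>n. real (card (code n ` E)) \<le> C * B ^ n"
    and diam: "\<And>n x y. x \<in> E \<Longrightarrow> y \<in> E \<Longrightarrow> code n x = code n y \<Longrightarrow> mdist m x y \<le> A / D ^ n"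
  shows "hausdorff_measure m t E = 0"
proof (rule hausdorff_measure_eq_0_by_codes[where r = "\<lambda>n. A / D ^ n" and card_bound = "\<lambda>n. C * B ^ n"])
  show "(\<lambda>n. A / D ^ n) \<longlonglongrightarrow> 0" using D by (intro LIMSEQ_divide_realpow_zero)
  have "C * B ^ n * (A / D ^ n) powr t = C * A powr t * (B / D powr t) ^ n" for n
  proof -
    have "(D ^ n) powr t = (D powr t) ^ n"
      using D by (simp add: powr_powr mult.commute flip: powr_realpow)
    then show ?thesis using AC D by (simp add: powr_divide power_divide)
  qed
  moreover have "0 < D powr t" using D by simp
  then have "0 \<le> B / D powr t" "B / D powr t < 1" using B by auto
  then have "(\<lambda>n. C * A powr t * (B / D powr t) ^ n) \<longlonglongrightarrow> C * A powr t * 0"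
    by (intro tendsto_mult tendsto_const LIMSEQ_realpow_zero)
  ultimately show "(\<lambda>n. C * B ^ n * (A / D ^ n) powr t) \<longlonglongrightarrow> 0"
    by (simp only: mult_zero_right)
  show "0 \<le> A / D ^ n" for n using AC D by simp
qed (fact t E fin card diam)+

text \<open>
  Mass distribution: if preimages of balls of radius \<open>r\<close> have mass at most \<open>K * r powr t\<close>, then every
  covering of the image has a \<open>t\<close>-sum of at least the total mass divided by \<open>K\<close>. The exponent \<open>u \<le> t\<close>
  is covered as well, since for sets of diameter at most 1 a smaller exponent gives a larger sum.
\<close>

lemma hausdorff_measure_neq_0_by_parametrization:
  fixes \<psi> :: "'b \<Rightarrow> 'a" and M :: "'b measure"
  assumes u: "0 \<le> u" "u \<le> t" "0 < t" and K: "0 < K"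
    and S: "S \<in> sets M" "0 < emeasure M S" and \<psi>: "\<psi> ` S \<subseteq> E"
    and ball: "\<And>s0 r. s0 \<in> S \<Longrightarrow> 0 \<le> r \<Longrightarrow>
      \<exists>R\<in>sets M. {s \<in> S. mdist m (\<psi> s0) (\<psi> s) \<le> r} \<subseteq> R \<and> emeasure M R \<le> ennreal (K * r powr t)"
  shows "hausdorff_measure m u E \<noteq> 0"
proof -
  define c where "c = emeasure M S / ennreal K"
  \<comment> \<open>A nonempty covering set lies in the ball around any of its points with its diameter as radius,
    so its preimage is controlled by the hypothesis on balls.\<close>
  have "c \<le> (\<Sum>n. diam_power m u (U n))"
    if U: "\<And>n. U n \<subseteq> mspace m" "\<And>n. mdiameter m (U n) \<le> ennreal 1" "E \<subseteq> (\<Union>n. U n)" for U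
  proof -
    have "\<exists>R\<in>sets M. {s \<in> S. \<psi> s \<in> U n} \<subseteq> R \<and> emeasure M R \<le> ennreal K * diam_power m u (U n)" for n
    proof (cases "\<exists>s0\<in>S. \<psi> s0 \<in> U n")
      case True
      then obtain s0 where s0: "s0 \<in> S" "\<psi> s0 \<in> U n" by blast
      define r where "r = enn2real (mdiameter m (U n))"
      have fin: "mdiameter m (U n) < top"
        using U(2)[of n] by (simp add: order_le_less_trans)
      have r: "0 \<le> r" "r \<le> 1"
        using U(2)[of n] by (auto simp: r_def enn2real_leI)
      obtain R where R: "R \<in> sets M" "{s \<in> S. mdist m (\<psi> s0) (\<psi> s) \<le> r} \<subseteq> R"
          "emeasure M R \<le> ennreal (K * r powr t)"
        using ball[OF s0(1) r(1)] by blast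
      have "{s \<in> S. \<psi> s \<in> U n} \<subseteq> {s \<in> S. mdist m (\<psi> s0) (\<psi> s) \<le> r}"
        using mdist_le_diameter[OF s0(2) _ fin] by (auto simp: r_def)
      moreover have "ennreal (K * r powr t) \<le> ennreal K * diam_power m u (U n)"
      proof (cases "u = 0")
        case True
        have "r powr t \<le> 1" using r u by (simp add: powr_le1)
        then have "K * r powr t \<le> K" using K by simp
        then show ?thesis
          using True s0(2) by (auto simp: diam_power_def intro!: ennreal_leI)
      next
        case False
        have "r powr t \<le> r powr u"
          using r u by (cases "r = 0") (auto intro: powr_mono')
        then have "K * r powr t \<le> K * r powr u" using K by simp
        then show ?thesis
          using False s0(2) K unfolding diam_power_def r_def[symmetric]
          by (auto simp: ennreal_mult[symmetric] intro!: ennreal_leI)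
      qed
      ultimately show ?thesis using R by (meson order_trans)
    next
      case False
      then show ?thesis by (intro bexI[of _ "{}"]) auto
    qed
    then obtain R where R: "\<And>n. R n \<in> sets M" "\<And>n. {s \<in> S. \<psi> s \<in> U n} \<subseteq> R n"
        "\<And>n. emeasure M (R n) \<le> ennreal K * diam_power m u (U n)"
      by metis
    have "S \<subseteq> (\<Union>n. R n)"
    proof
      fix s assume "s \<in> S"
      then obtain n where "\<psi> s \<in> U n" using \<psi> U(3) by blast
      then show "s \<in> (\<Union>n. R n)" using R(2) \<open>s \<in> S\<close> by blast
    qed
    then have "emeasure M S \<le> emeasure M (\<Union>n. R n)"
      using R(1) by (intro emeasure_mono) auto
    also have "\<dots> \<le> (\<Sum>n. emeasure M (R n))"
      using R(1) by (intro emeasure_subadditive_countably) auto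
    also have "\<dots> \<le> (\<Sum>n. ennreal K * diam_power m u (U n))"
      using R(3) by (intro suminf_le) auto
    also have "\<dots> = ennreal K * (\<Sum>n. diam_power m u (U n))"
      by simp
    finally show ?thesis
      unfolding c_def using K by (intro divide_le_posI_ennreal) (auto simp: mult.commute)
  qed
  then have "c \<le> hausdorff_premeasure m u 1 E"
    unfolding hausdorff_premeasure_def by (intro Inf_greatest) blast
  also have "\<dots> \<le> hausdorff_measure m u E"
    unfolding hausdorff_measure_def by (intro SUP_upper) auto
  finally have "c \<le> hausdorff_measure m u E" .
  moreover have "0 < c"
    unfolding c_def using S(2) by (simp add: ennreal_zero_less_divide)
  ultimately show ?thesis by auto
qed

lemma hausdorff_dim_eqI:
  assumes "0 \<le> D"
    and upper: "\<And>t. D < t \<Longrightarrow> hausdorff_measure m t E = 0"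
    and lower: "\<And>u. 0 \<le> u \<Longrightarrow> u < D \<Longrightarrow> hausdorff_measure m u E \<noteq> 0"
  shows "hausdorff_dim m E = ereal D"
proof (rule antisym)
  show "hausdorff_dim m E \<le> ereal D"
  proof (rule ereal_le_epsilon)
    fix e :: ereal assume "0 < e"
    then obtain d where d: "0 < d" "ereal d \<le> e"
      by (metis ereal_dense2 ereal_less(2) less_imp_le)
    have "hausdorff_dim m E \<le> ereal (D + d)"
      unfolding hausdorff_dim_def using assms(1) d(1)
      by (intro Inf_lower) (auto intro!: exI[of _ "D + d"] upper)
    also have "\<dots> \<le> ereal D + e"
      using d(2) by (metis add_left_mono plus_ereal.simps(1))
    finally show "hausdorff_dim m E \<le> ereal D + e" .
  qed
  show "ereal D \<le> hausdorff_dim m E"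
    unfolding hausdorff_dim_def using lower
    by (intro Inf_greatest) (auto, meson not_le)
qed

section \<open>Quasisymmetry by comparison of scales\<close>

text \<open>
  The level of a distance \<open>\<delta>\<close>: the power of \<open>1 / b\<close> that matches it up to a factor \<open>b\<close>.
\<close>

lemma exists_scale:
  fixes b \<delta> :: real
  assumes "1 < b" "0 < \<delta>" "\<delta> \<le> 1"
  shows "\<exists>m. 1 / b ^ Suc m < \<delta> \<and> \<delta> \<le> 1 / b ^ m"
proof -
  obtain n where "(1 / b) ^ n < \<delta>"
    using real_arch_pow_inv[of \<delta> "1 / b"] assms by auto
  then have ex: "\<exists>n. 1 / b ^ n < \<delta>" by (auto simp: power_one_over)
  define n where "n = (LEAST n. 1 / b ^ n < \<delta>)"
  have n: "1 / b ^ n < \<delta>" unfolding n_def using ex by (rule LeastI_ex)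
  then obtain m where m: "n = Suc m" using assms(3) by (cases n) auto
  have "\<not> 1 / b ^ m < \<delta>"
    using not_less_Least[of m "\<lambda>n. 1 / b ^ n < \<delta>"] m by (simp add: n_def)
  then show ?thesis using n m by (intro exI[of _ m]) auto
qed

text \<open>
  The control function of a map whose distortion is bounded by one power for small ratios and by
  another one for large ratios. The maximum of the two powers has an explicit continuous inverse,
  namely the minimum of the two inverse powers.
\<close>

lemma homeomorphic_map_max_powr:
  fixes a e C A :: real
  assumes "0 < a" "0 < e" "0 < C" "0 < A"
  shows "homeomorphic_map (top_of_set {0..}) (top_of_set {0..})
    (\<lambda>t. C * max ((A * t) powr a) ((A * t) powr e))"
proof -
  define f where "f t = C * max ((A * t) powr a) ((A * t) powr e)" for t
  define g where "g s = min ((s / C) powr (1/a)) ((s / C) powr (1/e)) / A" for s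
  have pow_inv: "(u powr x) powr (1/x) = u" "(u powr (1/x)) powr x = u"
    if "0 \<le> u" "0 < x" for u x :: real
    using that by (auto simp: powr_powr)
  have gf: "g (f t) = t" if "0 \<le> t" for t
  proof -
    define u where "u = A * t"
    have u: "0 \<le> u" using that assms by (simp add: u_def)
    define m where "m = max (u powr a) (u powr e)"
    have "(u powr a) powr (1/a) \<le> m powr (1/a)" "(u powr e) powr (1/e) \<le> m powr (1/e)"
      using assms by (auto simp: m_def intro!: powr_mono2)
    moreover have "m = u powr a \<or> m = u powr e" by (auto simp: m_def max_def)
    ultimately have "min (m powr (1/a)) (m powr (1/e)) = u"
      using pow_inv[OF u] assms by (auto simp: min_def)
    then show ?thesis
      using assms unfolding g_def f_def u_def m_def by simp
  qed
  have fg: "f (g s) = s" if "0 \<le> s" for s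
  proof -
    define v where "v = s / C"
    have v: "0 \<le> v" using that assms by (simp add: v_def)
    define m where "m = min (v powr (1/a)) (v powr (1/e))"
    have "m powr a \<le> (v powr (1/a)) powr a" "m powr e \<le> (v powr (1/e)) powr e"
      using assms by (auto simp: m_def intro!: powr_mono2)
    moreover have "m = v powr (1/a) \<or> m = v powr (1/e)" by (auto simp: m_def min_def)
    ultimately have "max (m powr a) (m powr e) = v"
      using pow_inv[OF v] assms by (auto simp: max_def)
    moreover have "A * g s = m" using assms by (simp add: g_def m_def v_def)
    ultimately show ?thesis
      using assms by (simp add: f_def v_def)
  qed
  have cf: "continuous_on {0..} f"
    unfolding f_def using assms
    by (intro continuous_on_mult continuous_on_max continuous_on_powr' continuous_on_const continuous_on_id) auto
  have cg: "continuous_on {0..} g"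
    unfolding g_def using assms
    by (intro continuous_on_divide continuous_on_min continuous_on_powr' continuous_on_const continuous_on_id) auto
  have f0: "0 \<le> f t" for t using assms by (simp add: f_def le_max_iff_disj)
  have g0: "0 \<le> g t" for t using assms by (simp add: g_def)
  have "homeomorphic_maps (top_of_set {0..}) (top_of_set {0..}) f g"
    unfolding homeomorphic_maps_def continuous_map_subtopology_eu
    by (simp add: continuous_map_in_subtopology cf cg gf fg f0 g0 image_subset_iff Pi_iff)
  then have "homeomorphic_map (top_of_set {0..}) (top_of_set {0..}) f"
    by (auto simp: homeomorphic_map_maps)
  then show ?thesis by (simp add: f_def[abs_def])
qed

lemma (in Metric_space) openin_mtopology_iff_dist:
  "openin mtopology U \<longleftrightarrow>
    U \<subseteq> M \<and> (\<forall>x\<in>U. \<exists>r>0. \<forall>y\<in>M. d x y < r \<longrightarrow> y \<in> U)"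
proof -
  have "mball x r \<subseteq> U \<longleftrightarrow> (\<forall>y\<in>M. d x y < r \<longrightarrow> y \<in> U)" if "x \<in> M" for x r
    using that by (auto simp: in_mball)
  then show ?thesis
    unfolding openin_mtopology by (metis subsetD)
qed

text \<open>
  Both metrics are compared with a common ladder of scales: if the distance of \<open>x\<close> and \<open>y\<close> is about
  \<open>1 / b ^ n\<close> in \<open>X\<close>, then it is about \<open>V x n\<close> in \<open>Y\<close>. The decay of \<open>V x\<close> lies between two
  geometric rates, so a ratio of distances from \<open>x\<close> is turned into at most a power of it. The
  exponents come from the two rates.
\<close>

lemma quasisymmetric_id_by_scales:
  fixes X Y :: "'a metric" and V :: "'a \<Rightarrow> nat \<Rightarrow> real" and b p q A :: real
  assumes same: "mspace X = mspace Y" and b: "1 < b" and A: "0 < A"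
    and pq: "0 < p" "0 < q" "q < 1"
    and Vpos: "\<And>x n. x \<in> mspace X \<Longrightarrow> 0 < V x n"
    and Vup: "\<And>x n. x \<in> mspace X \<Longrightarrow> V x (Suc n) \<le> q * V x n"
    and Vlo: "\<And>x n. x \<in> mspace X \<Longrightarrow> p * V x n \<le> V x (Suc n)"
    and scale: "\<And>x y. x \<in> mspace X \<Longrightarrow> y \<in> mspace X \<Longrightarrow> x \<noteq> y \<Longrightarrow>
      \<exists>n. mdist X x y \<le> A / b ^ n \<and> 1 / b ^ n \<le> A * mdist X x y \<and>
          mdist Y x y \<le> A * V x n \<and> V x n \<le> A * mdist Y x y"
  shows "quasisymmetric X Y id"
proof -
  have Vup': "V x (n + k) \<le> q ^ k * V x n" if "x \<in> mspace X" for x n k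
  proof (induction k)
    case (Suc k)
    have "V x (n + Suc k) \<le> q * V x (n + k)" using Vup[OF that] by simp
    also have "\<dots> \<le> q * (q ^ k * V x n)" using Suc pq by (intro mult_left_mono) auto
    finally show ?case by (simp add: mult_ac)
  qed auto
  have Vlo': "p ^ k * V x n \<le> V x (n + k)" if "x \<in> mspace X" for x n k
  proof (induction k)
    case (Suc k)
    have "p * (p ^ k * V x n) \<le> p * V x (n + k)" using Suc pq by (intro mult_left_mono) auto
    also have "\<dots> \<le> V x (n + Suc k)" using Vlo[OF that] by simp
    finally show ?case by (simp add: mult_ac)
  qed auto
  have anti: "V x n \<le> V x m" if "x \<in> mspace X" "m \<le> n" for x m n
  proof -
    have "V x n \<le> q ^ (n - m) * V x m" using Vup'[OF that(1), of m "n - m"] that by simp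
    also have "\<dots> \<le> 1 * V x m"
      using pq Vpos[OF that(1), of m] by (intro mult_right_mono) (auto simp: power_le_one)
    finally show ?thesis by simp
  qed
  have V0: "V x \<longlonglongrightarrow> 0" if "x \<in> mspace X" for x
  proof (rule tendsto_sandwich[of "\<lambda>_. 0" _ _ "\<lambda>n. q ^ n * V x 0"])
    show "\<forall>\<^sub>F n in sequentially. 0 \<le> V x n" using Vpos[OF that] by (auto simp: less_imp_le)
    show "\<forall>\<^sub>F n in sequentially. V x n \<le> q ^ n * V x 0" using Vup'[OF that, of 0] by auto
    show "(\<lambda>n. q ^ n * V x 0) \<longlonglongrightarrow> 0"
      using LIMSEQ_realpow_zero[of q] pq by (auto intro!: tendsto_eq_intros)
  qed auto
  interpret MX: Metric_space "mspace X" "mdist X" by simp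
  interpret MY: Metric_space "mspace Y" "mdist Y" by simp
  have dXpos: "0 < mdist X x y" if "x \<in> mspace X" "y \<in> mspace X" "x \<noteq> y" for x y
    using that MX.mdist_pos_less by auto
  have dYpos: "0 < mdist Y x y" if "x \<in> mspace X" "y \<in> mspace X" "x \<noteq> y" for x y
    using that MY.mdist_pos_less same by auto
  have XY: "\<exists>r'>0. \<forall>y\<in>mspace X. mdist X x y < r' \<longrightarrow> mdist Y x y < r"
    if "x \<in> mspace X" "0 < r" for x r
  proof -
    have "\<forall>\<^sub>F n in sequentially. V x n < r / A"
      using V0[OF that(1)] that A by (intro order_tendstoD) auto
    then obtain n0 where n0: "V x n0 < r / A" by (auto simp: eventually_sequentially)
    have "mdist Y x y < r" if y: "y \<in> mspace X" "mdist X x y < 1 / (A * b ^ n0)" for y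
    proof (cases "x = y")
      case False
      obtain n where n: "1 / b ^ n \<le> A * mdist X x y" "mdist Y x y \<le> A * V x n"
        using scale[OF \<open>x \<in> mspace X\<close> y(1) False] by blast
      have "1 / b ^ n < 1 / b ^ n0"
      proof -
        have "A * mdist X x y < A * (1 / (A * b ^ n0))"
          using y(2) A by (intro mult_strict_left_mono) auto
        then show ?thesis using n(1) A by simp
      qed
      then have "b ^ n0 < b ^ n" using b by (simp add: field_simps)
      then have "n0 \<le> n" using b by (meson less_imp_le power_less_imp_less_exp)
      then have "A * V x n \<le> A * V x n0" using anti \<open>x \<in> mspace X\<close> A by simp
      moreover have "A * V x n0 < r" using n0 A by (simp add: field_simps)
      ultimately show ?thesis using n(2) by linarith
    qed (use \<open>0 < r\<close> same y(1) in auto)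
    then show ?thesis using A b by (intro exI[of _ "1 / (A * b ^ n0)"]) auto
  qed
  have YX: "\<exists>r'>0. \<forall>y\<in>mspace X. mdist Y x y < r' \<longrightarrow> mdist X x y < r"
    if "x \<in> mspace X" "0 < r" for x r
  proof -
    obtain n0 where n0: "(1 / b) ^ n0 < r / A"
      using real_arch_pow_inv[of "r / A" "1 / b"] \<open>0 < r\<close> A b by auto
    have "mdist X x y < r" if y: "y \<in> mspace X" "mdist Y x y < V x n0 / A" for y
    proof (cases "x = y")
      case False
      obtain n where n: "mdist X x y \<le> A / b ^ n" "V x n \<le> A * mdist Y x y"
        using scale[OF \<open>x \<in> mspace X\<close> y(1) False] by blast
      have "V x n < V x n0"
        using n(2) y(2) A by (simp add: field_simps)
      then have "n0 \<le> n" using anti[OF \<open>x \<in> mspace X\<close>, of n n0] by linarith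
      then have "A / b ^ n \<le> A / b ^ n0" using A b by (intro divide_left_mono) auto
      then show ?thesis using n(1) n0 A by (simp add: field_simps)
    qed (use \<open>0 < r\<close> same y(1) in auto)
    then show ?thesis using A Vpos[OF that(1)] by (intro exI[of _ "V x n0 / A"]) auto
  qed
  \<comment> \<open>Small distances in one metric mean large levels, and these mean small distances in the other.\<close>
  have top: "mtopology_of X = mtopology_of Y"
  proof (rule topology_eq[THEN iffD2], intro allI)
    fix U
    have "openin MX.mtopology U \<longleftrightarrow> U \<subseteq> mspace X \<and> (\<forall>x\<in>U. \<exists>r>0. \<forall>y\<in>mspace X. mdist X x y < r \<longrightarrow> y \<in> U)"
      by (rule MX.openin_mtopology_iff_dist)
    also have "\<dots> \<longleftrightarrow> U \<subseteq> mspace Y \<and> (\<forall>x\<in>U. \<exists>r>0. \<forall>y\<in>mspace Y. mdist Y x y < r \<longrightarrow> y \<in> U)"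
    proof -
      have "(\<exists>r>0. \<forall>y\<in>mspace X. mdist X x y < r \<longrightarrow> y \<in> U) \<longleftrightarrow>
          (\<exists>r>0. \<forall>y\<in>mspace X. mdist Y x y < r \<longrightarrow> y \<in> U)" if "x \<in> mspace X" for x
        using XY[OF that] YX[OF that] by metis
      then show ?thesis unfolding same[symmetric] by blast
    qed
    also have "\<dots> \<longleftrightarrow> openin MY.mtopology U"
      by (rule MY.openin_mtopology_iff_dist[symmetric])
    finally show "openin (mtopology_of X) U = openin (mtopology_of Y) U"
      by (simp add: mtopology_of_def)
  qed
  \<comment> \<open>The decay rates of the scales, as exponents: \<open>q = b powr (- a)\<close> and \<open>1 / p \<le> b powr e\<close>. The
    maximum with 1 only ensures that \<open>e\<close> is positive.\<close>
  define a where "a = - log b q"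
  define e where "e = max 1 (- log b p)"
  have a: "0 < a" "q = b powr (-a)" using pq b by (auto simp: a_def)
  have e: "0 < e" "1 / p \<le> b powr e"
  proof -
    have "1 / p = b powr (- log b p)" using pq b by (simp add: powr_minus_divide)
    also have "\<dots> \<le> b powr e" using b by (intro powr_mono) (auto simp: e_def)
    finally show "1 / p \<le> b powr e" .
  qed (simp add: e_def)
  define \<eta> where "\<eta> t = A^2 * max ((A^2 * t) powr a) ((A^2 * t) powr e)" for t
  have main: "mdist Y x y / mdist Y x z \<le> \<eta> (mdist X x y / mdist X x z)"
    if xyz: "x \<in> mspace X" "y \<in> mspace X" "z \<in> mspace X" "x \<noteq> y" "x \<noteq> z" for x y z
  proof -
    define t where "t = mdist X x y / mdist X x z"
    obtain n where n: "1 / b ^ n \<le> A * mdist X x y" "mdist Y x y \<le> A * V x n"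
      using scale xyz by blast
    obtain m where m: "mdist X x z \<le> A / b ^ m" "V x m \<le> A * mdist Y x z"
      using scale xyz by blast
    have pos: "0 < mdist X x y" "0 < mdist X x z" "0 < mdist Y x y" "0 < mdist Y x z" "0 < V x m" "0 < V x n"
      using dXpos dYpos Vpos xyz by auto
    have "b ^ m / b ^ n \<le> A^2 * t"
    proof -
      have "b ^ m * mdist X x z \<le> A" using m(1) b by (simp add: field_simps)
      then have "b ^ m / b ^ n * mdist X x z \<le> A * (1 / b ^ n)" using b by (simp add: field_simps)
      also have "\<dots> \<le> A * (A * mdist X x y)" using n(1) A by (intro mult_left_mono) auto
      finally show ?thesis using pos by (simp add: t_def field_simps power2_eq_square)
    qed
    have "V x n / V x m \<le> max ((A^2 * t) powr a) ((A^2 * t) powr e)"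
    proof (cases "m \<le> n")
      case True
      define k where "k = n - m"
      have "V x n / V x m \<le> q ^ k"
        using Vup'[OF xyz(1), of m k] True pos by (simp add: k_def field_simps)
      also have "\<dots> = (b ^ m / b ^ n) powr a"
      proof -
        have "b ^ m / b ^ n = b powr (- real k)"
          using True b power_add[of b m k] by (simp add: k_def[symmetric] powr_minus powr_realpow field_simps) (simp add: k_def)
        then have "(b ^ m / b ^ n) powr a = b powr (- a * real k)" by (simp add: powr_powr mult.commute)
        also have "\<dots> = q ^ k" using a b by (simp add: powr_powr flip: powr_realpow)
        finally show ?thesis by simp
      qed
      also have "\<dots> \<le> (A^2 * t) powr a"
        using \<open>b ^ m / b ^ n \<le> A^2 * t\<close> a b by (intro powr_mono2) auto
      finally show ?thesis by simp
    next
      case False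
      define k where "k = m - n"
      have "V x n / V x m \<le> (1 / p) ^ k"
        using Vlo'[OF xyz(1), of k n] False pos pq by (simp add: k_def field_simps)
      also have "\<dots> \<le> (b powr e) ^ k" using e pq by (intro power_mono) auto
      also have "\<dots> = (b ^ m / b ^ n) powr e"
      proof -
        have "b ^ m / b ^ n = b powr (real k)"
          using False b power_add[of b n k] by (simp add: k_def[symmetric] powr_realpow field_simps) (simp add: k_def)
        then have "(b ^ m / b ^ n) powr e = b powr (e * real k)" by (simp add: powr_powr mult.commute)
        also have "\<dots> = (b powr e) ^ k" using b by (simp add: powr_powr flip: powr_realpow)
        finally show ?thesis by simp
      qed
      also have "\<dots> \<le> (A^2 * t) powr e"
        using \<open>b ^ m / b ^ n \<le> A^2 * t\<close> e b by (intro powr_mono2) auto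
      finally show ?thesis by simp
    qed
    moreover have "mdist Y x y / mdist Y x z \<le> A^2 * (V x n / V x m)"
    proof -
      have "mdist Y x y * V x m \<le> (A * V x n) * (A * mdist Y x z)"
        using n(2) m(2) pos A by (intro mult_mono) auto
      then show ?thesis using pos by (simp add: field_simps power2_eq_square)
    qed
    ultimately show ?thesis
      unfolding \<eta>_def t_def[symmetric] using A
      by (meson mult_left_mono order_trans zero_le_power2)
  qed
  have "homeomorphic_map (top_of_set {0..}) (top_of_set {0..}) \<eta>"
    unfolding \<eta>_def[abs_def] using a(1) e(1) A by (intro homeomorphic_map_max_powr) auto
  moreover have "homeomorphic_map (mtopology_of X) (mtopology_of Y) id"
    unfolding top by (rule homeomorphic_map_id[THEN iffD2, OF refl])
  ultimately show ?thesis
    unfolding quasisymmetric_def id_apply using main by (intro conjI exI[of _ \<eta>] ballI impI) auto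
qed

section \<open>A singular doubling measure on the vertical axis\<close>

lemma nat_floor_mult_div:
  fixes m :: nat and t :: real
  assumes "0 < m" "0 \<le> t"
  shows "nat \<lfloor>real m * t\<rfloor> div m = nat \<lfloor>t\<rfloor>"
proof -
  have "\<lfloor>real m * t / real_of_int (int m)\<rfloor> = \<lfloor>real m * t\<rfloor> div int m"
    by (rule floor_divide_real_eq_div) simp
  then have "\<lfloor>t\<rfloor> = \<lfloor>real m * t\<rfloor> div int m" using assms by simp
  then show ?thesis using assms by (simp add: nat_div_distrib)
qed

text \<open>
  The base is a square because the estimate of the heavy cells uses the square root of \<open>b\<close>; the
  bound 7 makes the total length of the heavy cells less than one half.
\<close>

locale scale_base =
  fixes b c :: nat
  assumes c7: "7 \<le> c" and b_eq: "b = c ^ 2"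
begin

lemma b49: "49 \<le> b"
proof -
  have "7 ^ 2 \<le> c ^ 2" using c7 by (rule power_mono) simp
  then show ?thesis by (simp add: b_eq)
qed

text \<open>
  The index of the base \<open>b\<close> interval of length \<open>1 / b ^ n\<close> that contains \<open>y\<close>. The last \<open>n\<close> base \<open>b\<close>
  digits of this index are the first \<open>n\<close> fractional digits of \<open>y\<close>.
\<close>

definition cell :: "nat \<Rightarrow> real \<Rightarrow> nat" where
  "cell n y = nat \<lfloor>real b ^ n * y\<rfloor>"

lemma cell_bounds:
  assumes "0 \<le> y"
  shows "real (cell n y) \<le> real b ^ n * y" "real b ^ n * y < real (cell n y) + 1"
proof -
  have "0 \<le> \<lfloor>real b ^ n * y\<rfloor>" using assms by simp
  then have "real (cell n y) = real_of_int \<lfloor>real b ^ n * y\<rfloor>"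
    by (simp add: cell_def)
  then show "real (cell n y) \<le> real b ^ n * y" "real b ^ n * y < real (cell n y) + 1"
    by linarith+
qed

lemma cell_eqI:
  assumes "real k \<le> real b ^ n * y" "real b ^ n * y < real k + 1"
  shows "cell n y = k"
proof -
  have "\<lfloor>real b ^ n * y\<rfloor> = int k" using assms by (intro floor_unique) auto
  then show ?thesis by (simp add: cell_def)
qed

lemma cell_0: "0 \<le> y \<Longrightarrow> y < 1 \<Longrightarrow> cell 0 y = 0"
  by (intro cell_eqI) auto

lemma cell_mono: "x \<le> y \<Longrightarrow> cell n x \<le> cell n y"
  unfolding cell_def by (intro nat_mono floor_mono mult_left_mono) auto

lemma cell_less_power: "0 \<le> y \<Longrightarrow> y < 1 \<Longrightarrow> cell n y < b ^ n"
proof -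
  assume "0 \<le> y" "y < 1"
  then have "real b ^ n * y < real b ^ n * 1"
    using b49 by (intro mult_strict_left_mono) auto
  with cell_bounds(1)[OF \<open>0 \<le> y\<close>, of n] have "real (cell n y) < real b ^ n" by linarith
  then show "cell n y < b ^ n" by (metis of_nat_less_iff of_nat_power)
qed

lemma cell_Suc_div:
  assumes "0 \<le> y"
  shows "cell (Suc n) y div b = cell n y"
  using nat_floor_mult_div[of b "real b ^ n * y"] b49 assms by (simp add: cell_def mult.assoc)

lemma cell_Suc:
  assumes "0 \<le> y"
  shows "cell (Suc n) y = b * cell n y + cell (Suc n) y mod b"
  using cell_Suc_div[OF assms, of n] by (metis mult_div_mod_eq)

lemma cell_eq_mono:
  assumes "0 \<le> x" "0 \<le> y" "cell n x = cell n y" "m \<le> n"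
  shows "cell m x = cell m y"
  using assms(4,3)
proof (induction rule: inc_induct)
  case (step m)
  then show ?case using cell_Suc_div assms(1,2) by metis
qed auto

lemma cell_eq_imp_close:
  assumes "0 \<le> x" "0 \<le> y" "cell n x = cell n y"
  shows "\<bar>x - y\<bar> < 1 / real b ^ n"
proof -
  have "\<bar>real b ^ n * x - real b ^ n * y\<bar> < 1"
    using cell_bounds[OF assms(1), of n] cell_bounds[OF assms(2), of n] assms(3) by linarith
  then have "real b ^ n * \<bar>x - y\<bar> < 1"
    by (simp add: abs_mult right_diff_distrib[symmetric])
  then show ?thesis using b49 by (simp add: field_simps)
qed

lemma cell_Suc_of_close:
  assumes "0 \<le> y" "y \<le> y'" "y' - y \<le> 1 / real b ^ n"
  shows "cell n y' = cell n y \<or> cell n y' = Suc (cell n y)"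
proof -
  have "real b ^ n * (y' - y) \<le> 1" using assms(3) b49 by (simp add: field_simps)
  then have "real (cell n y') < real (cell n y) + 2"
    using cell_bounds[OF assms(1), of n] cell_bounds[of y' n] assms by (simp add: algebra_simps)
  then show ?thesis using cell_mono[OF assms(2), of n] by linarith
qed

lemma cell_of_far:
  assumes "0 \<le> y" "y \<le> y'" "2 / real b ^ n \<le> y' - y"
  shows "cell n y + 2 \<le> cell n y'"
proof -
  have "2 \<le> real b ^ n * (y' - y)" using assms(3) b49 by (simp add: field_simps)
  then have "real (cell n y) + 1 < real (cell n y')"
    using cell_bounds[OF assms(1), of n] cell_bounds[of y' n] assms by (simp add: algebra_simps)
  then show ?thesis by linarith
qed

text \<open>
  The mass of every digit other than 1. The fourth power of \<open>1 / b\<close> is small enough for the estimate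
  of the heavy cells, where fourth roots of the masses are summed.
\<close>

definition light :: real where "light = 1 / real b ^ 4"

definition digit_weight :: "nat \<Rightarrow> real" where
  "digit_weight d = (if d = 1 then 1 - (real b - 1) * light else light)"

text \<open>
  The mass of the cell \<open>j\<close> of level \<open>n\<close>. For indices of at least \<open>b ^ n\<close> this is the periodic
  extension, so that cells at the ends of the unit interval have neighbours like any others.
\<close>

primrec weight :: "nat \<Rightarrow> nat \<Rightarrow> real" where
  "weight 0 j = 1"
| "weight (Suc n) j = weight n (j div b) * digit_weight (j mod b)"

lemma light: "0 < light" "light < 1" "real b * light \<le> 1 / 2" "light \<le> 1 / 2"
proof -
  have b: "49 \<le> real b" using b49 by simp
  show "0 < light" using b by (simp add: light_def)
  have "real b ^ 1 * 2 \<le> real b ^ 3 * real b" using b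
    by (intro mult_mono power_increasing) auto
  then show *: "real b * light \<le> 1 / 2"
    using b by (simp add: light_def field_simps power_numeral_reduce)
  have "1 * light \<le> real b * light" using b \<open>0 < light\<close> by (intro mult_right_mono) auto
  with * show "light \<le> 1 / 2" by simp
  then show "light < 1" by simp
qed

lemma digit_weight: "light \<le> digit_weight d" "digit_weight d \<le> 1 - light" "0 < digit_weight d"
proof -
  have b: "49 \<le> real b" using b49 by simp
  have "1 * light \<le> (real b - 1) * light" using b light(1) by (intro mult_right_mono) auto
  then show "light \<le> digit_weight d" "digit_weight d \<le> 1 - light" "0 < digit_weight d"
    using light b by (auto simp: digit_weight_def algebra_simps)
qed

lemma digit_weight_le_1: "digit_weight d \<le> 1"
  using digit_weight(2)[of d] light(1) by simp

lemma weight_pos: "0 < weight n j"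
  by (induction n arbitrary: j) (auto simp: digit_weight(3))

lemma weight_Suc_le: "weight (Suc n) j \<le> (1 - light) * weight n (j div b)"
  using digit_weight(2)[of "j mod b"] weight_pos[of n "j div b"] by (simp add: mult.commute)

lemma weight_Suc_ge: "light * weight n (j div b) \<le> weight (Suc n) j"
  using digit_weight(1)[of "j mod b"] weight_pos[of n "j div b"] by (simp add: mult.commute)

lemma sum_digit_weight: "(\<Sum>d<b. digit_weight d) = 1"
proof -
  have "(\<Sum>d<b. digit_weight d) = digit_weight 1 + (\<Sum>d\<in>{..<b} - {1}. digit_weight d)"
    using b49 by (intro sum.remove) auto
  also have "(\<Sum>d\<in>{..<b} - {1}. digit_weight d) = (\<Sum>d\<in>{..<b} - {1}. light)"
    by (intro sum.cong) (auto simp: digit_weight_def)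
  also have "\<dots> = (real b - 1) * light" using b49 by (simp add: of_nat_diff)
  finally show ?thesis by (simp add: digit_weight_def)
qed

lemma sum_blocks: "(\<Sum>j<b * k. g j) = (\<Sum>i<k. \<Sum>d<b. g (b * i + d))"
  for g :: "nat \<Rightarrow> real"
proof -
  have "(\<Sum>j<b * k. g j) = (\<Sum>i<k. sum g {i * b..<i * b + b})"
    using sum.nat_group[of g b k] by (simp add: mult.commute)
  also have "\<dots> = (\<Sum>i<k. \<Sum>d<b. g (b * i + d))"
  proof (rule sum.cong[OF refl])
    fix i
    show "sum g {i * b..<i * b + b} = (\<Sum>d<b. g (b * i + d))"
      using sum.shift_bounds_nat_ivl[of g 0 "i * b" b]
      by (simp add: atLeast0LessThan add.commute mult.commute)
  qed
  finally show ?thesis .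
qed

text \<open>
  Doubling. Passing from \<open>j\<close> to \<open>j + 1\<close> turns the final digits \<open>b - 1\<close> of \<open>j\<close> into zeros and changes
  at most one further digit. Both \<open>0\<close> and \<open>b - 1\<close> are light, so only that further digit contributes to
  the ratio of the masses.
\<close>

lemma weight_adjacent:
  "light * weight n j \<le> weight n (Suc j)" "light * weight n (Suc j) \<le> weight n j"
proof -
  have "light * weight n j \<le> weight n (Suc j) \<and> light * weight n (Suc j) \<le> weight n j"
  proof (induction n arbitrary: j)
    case 0
    then show ?case using light by simp
  next
    case (Suc n)
    have *: "light * digit_weight d \<le> digit_weight d'" for d d'
      using digit_weight(1)[of d'] digit_weight_le_1[of d] light mult_left_le[of "digit_weight d" light]
      by linarith
    show ?case
    proof (cases "Suc (j mod b) = b")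
      case True
      have "Suc j mod b = 0" "Suc j div b = Suc (j div b)"
        using True by (auto simp: mod_Suc div_Suc)
      moreover have "digit_weight (j mod b) = light" "digit_weight 0 = light"
        using True b49 by (auto simp: digit_weight_def)
      ultimately show ?thesis
        using Suc[of "j div b"] light(1) by (simp add: mult.left_commute mult.commute)
    next
      case False
      then have "Suc j div b = j div b" by (simp add: div_Suc mod_Suc)
      then show ?thesis using * weight_pos[of n "j div b"] by (simp add: mult.left_commute)
    qed
  qed
  then show "light * weight n j \<le> weight n (Suc j)" "light * weight n (Suc j) \<le> weight n j" by auto
qed

definition cumulative :: "nat \<Rightarrow> nat \<Rightarrow> real" where
  "cumulative n k = (\<Sum>j<k. weight n j)"

lemma cumulative_Suc: "cumulative n (Suc k) = cumulative n k + weight n k"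
  by (simp add: cumulative_def)

lemma cumulative_mono: "k \<le> l \<Longrightarrow> cumulative n k \<le> cumulative n l"
  unfolding cumulative_def by (intro sum_mono2 less_imp_le[OF weight_pos]) auto

lemma cumulative_refine: "cumulative (Suc n) (b * k) = cumulative n k"
proof -
  have "cumulative (Suc n) (b * k) = (\<Sum>i<k. \<Sum>d<b. weight (Suc n) (b * i + d))"
    unfolding cumulative_def by (rule sum_blocks)
  also have "\<dots> = (\<Sum>i<k. \<Sum>d<b. weight n i * digit_weight d)"
    using b49 by (intro sum.cong) auto
  also have "\<dots> = cumulative n k"
    by (simp add: sum_distrib_left[symmetric] sum_digit_weight cumulative_def)
  finally show ?thesis .
qed

text \<open>
  The distribution function of the measure. Its values lie between the cumulative masses of the
  cells to the left of \<open>y\<close>, without and with the cell of \<open>y\<close> itself.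
\<close>

definition height :: "real \<Rightarrow> real" where
  "height y = (SUP n. cumulative n (cell n y))"

lemma height_bounds:
  assumes "0 \<le> y"
  shows "cumulative n (cell n y) \<le> height y" "height y \<le> cumulative n (Suc (cell n y))"
proof -
  have inc: "cumulative n (cell n y) \<le> cumulative (Suc n) (cell (Suc n) y)" for n
  proof -
    have "b * cell n y \<le> cell (Suc n) y" using cell_Suc[OF assms, of n] by linarith
    then show ?thesis using cumulative_mono[of _ _ "Suc n"] cumulative_refine[of n] by metis
  qed
  have dec: "cumulative (Suc n) (Suc (cell (Suc n) y)) \<le> cumulative n (Suc (cell n y))" for n
  proof -
    have "cell (Suc n) y mod b < b" using b49 by simp
    then have "Suc (cell (Suc n) y) \<le> b * Suc (cell n y)"
      using cell_Suc[OF assms, of n] by simp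
    then show ?thesis using cumulative_mono[of _ _ "Suc n"] cumulative_refine[of n] by metis
  qed
  have le: "cumulative m (cell m y) \<le> cumulative n (Suc (cell n y))" for m n
  proof -
    have "cumulative m (cell m y) \<le> cumulative (max m n) (cell (max m n) y)"
      using incseqD[OF incseq_SucI[of "\<lambda>n. cumulative n (cell n y)", OF inc]] by simp
    also have "\<dots> \<le> cumulative (max m n) (Suc (cell (max m n) y))"
      by (intro cumulative_mono) simp
    also have "\<dots> \<le> cumulative n (Suc (cell n y))"
      using decseqD[OF decseq_SucI[of "\<lambda>n. cumulative n (Suc (cell n y))", OF dec]] by simp
    finally show ?thesis .
  qed
  then have "bdd_above (range (\<lambda>m. cumulative m (cell m y)))" by (intro bdd_aboveI2) 
  then show "cumulative n (cell n y) \<le> height y"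
    unfolding height_def by (intro cSUP_upper) auto
  show "height y \<le> cumulative n (Suc (cell n y))"
    unfolding height_def using le by (intro cSUP_least) auto
qed

text \<open>
  The mass at the scale \<open>1 / b ^ n\<close> around the height \<open>y\<close>.
\<close>

definition cell_weight :: "nat \<Rightarrow> real \<Rightarrow> real" where
  "cell_weight n y = weight n (cell n y)"

lemma cell_weight_pos: "0 < cell_weight n y"
  by (simp add: cell_weight_def weight_pos)

lemma cell_weight_Suc:
  assumes "0 \<le> y"
  shows "cell_weight (Suc n) y \<le> (1 - light) * cell_weight n y"
    "light * cell_weight n y \<le> cell_weight (Suc n) y"
  unfolding cell_weight_def
  using weight_Suc_le[of n "cell (Suc n) y"] weight_Suc_ge[of n "cell (Suc n) y"] cell_Suc_div[OF assms]
  by auto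

lemma cell_weight_antimono:
  assumes "0 \<le> y" "m \<le> n"
  shows "cell_weight n y \<le> cell_weight m y"
  using assms(2)
proof (induction rule: dec_induct)
  case (step n)
  have "cell_weight (Suc n) y \<le> (1 - light) * cell_weight n y"
    using cell_weight_Suc(1)[OF assms(1)] .
  also have "\<dots> \<le> 1 * cell_weight n y"
    using light cell_weight_pos[of n y] by (intro mult_right_mono) auto
  finally show ?case using step by simp
qed simp

lemma cell_weight_tendsto_0:
  assumes "0 \<le> y"
  shows "(\<lambda>n. cell_weight n y) \<longlonglongrightarrow> 0"
proof -
  have "cell_weight n y \<le> (1 - light) ^ n" for n
  proof (induction n)
    case (Suc n)
    have "cell_weight (Suc n) y \<le> (1 - light) * cell_weight n y"
      using cell_weight_Suc(1)[OF assms] .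
    also have "\<dots> \<le> (1 - light) * (1 - light) ^ n" using Suc light by (intro mult_left_mono) auto
    finally show ?case by simp
  qed (simp add: cell_weight_def)
  then have up: "\<forall>\<^sub>F n in sequentially. cell_weight n y \<le> (1 - light) ^ n"
    by (intro always_eventually allI)
  have low: "\<forall>\<^sub>F n in sequentially. 0 \<le> cell_weight n y"
    by (intro always_eventually allI less_imp_le cell_weight_pos)
  have "(\<lambda>n. (1 - light) ^ n) \<longlonglongrightarrow> 0"
    using light by (intro LIMSEQ_realpow_zero) auto
  with low up show ?thesis
    by (rule tendsto_sandwich[OF _ _ tendsto_const])
qed

lemma height_diff_same_cell:
  assumes "0 \<le> y" "0 \<le> y'" "cell n y = cell n y'"
  shows "\<bar>height y - height y'\<bar> \<le> cell_weight n y"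
  using height_bounds[OF assms(1), of n] height_bounds[OF assms(2), of n] assms(3)
  by (simp add: cumulative_Suc cell_weight_def)

lemma height_close:
  assumes "0 \<le> y" "0 \<le> y'" "\<bar>y - y'\<bar> \<le> 1 / real b ^ n"
  shows "\<bar>height y - height y'\<bar> \<le> 2 / light * cell_weight n y"
    and "light * cell_weight n y \<le> cell_weight n y'"
proof -
  have *: "\<bar>height y - height y'\<bar> \<le> weight n (cell n y) + weight n (cell n y') \<and>
      light * cell_weight n y \<le> cell_weight n y' \<and> light * cell_weight n y' \<le> cell_weight n y"
    if "0 \<le> y" "y \<le> y'" "y' - y \<le> 1 / real b ^ n" for y y'
  proof -
    have *: "light * weight n j \<le> weight n j" for j
      using light weight_pos[of n j] by (simp add: mult_left_le_one_le)
    have "0 \<le> y'" using that by simp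
    note h = height_bounds[OF \<open>0 \<le> y\<close>, of n] height_bounds[OF \<open>0 \<le> y'\<close>, of n]
    from cell_Suc_of_close[OF that] show ?thesis
    proof
      assume e: "cell n y' = cell n y"
      show ?thesis using h * weight_pos[of n "cell n y"]
        unfolding cell_weight_def e cumulative_Suc by auto
    next
      assume e: "cell n y' = Suc (cell n y)"
      show ?thesis using h weight_adjacent[of n "cell n y"] weight_pos[of n "cell n y"]
          weight_pos[of n "Suc (cell n y)"]
        unfolding cell_weight_def e cumulative_Suc by auto
    qed
  qed
  have **: "\<bar>height y - height y'\<bar> \<le> weight n (cell n y) + weight n (cell n y') \<and>
      light * cell_weight n y \<le> cell_weight n y' \<and> light * cell_weight n y' \<le> cell_weight n y"
  proof (cases "y \<le> y'")
    case True
    then show ?thesis using *[of y y'] assms by auto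
  next
    case False
    then show ?thesis using *[of y' y] assms by auto
  qed
  then show "light * cell_weight n y \<le> cell_weight n y'" by simp
  have "light * weight n (cell n y) \<le> weight n (cell n y)"
    using light weight_pos[of n] by (simp add: mult_left_le_one_le less_imp_le)
  then have "light * \<bar>height y - height y'\<bar> \<le> 2 * cell_weight n y"
    using ** mult_left_mono[of "\<bar>height y - height y'\<bar>" "weight n (cell n y) + weight n (cell n y')" light] light
    unfolding cell_weight_def by (simp add: distrib_left)
  then show "\<bar>height y - height y'\<bar> \<le> 2 / light * cell_weight n y"
    using light by (simp add: field_simps)
qed

text \<open>
  Heights that differ by half a cell of level \<open>n\<close> have an entire cell of level \<open>n + 1\<close> between them,
  and this cell can be chosen next to the one of \<open>y\<close>.
\<close>

lemma height_far:
  assumes "0 \<le> y" "0 \<le> y'" "1 / real b ^ n / 2 \<le> \<bar>y - y'\<bar>"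
  shows "light\<^sup>2 * cell_weight n y \<le> \<bar>height y - height y'\<bar>"
proof -
  have two: "2 / real b ^ Suc n \<le> 1 / real b ^ n / 2"
    using b49 by (simp add: field_simps)
  have "light * cell_weight (Suc n) y \<le> \<bar>height y - height y'\<bar>"
  proof (cases "y \<le> y'")
    case True
    have "cell (Suc n) y + 2 \<le> cell (Suc n) y'"
      using cell_of_far[OF assms(1) True] assms(3) two True by simp
    then have "cumulative (Suc n) (Suc (Suc (cell (Suc n) y))) \<le> cumulative (Suc n) (cell (Suc n) y')"
      by (intro cumulative_mono) simp
    then have "weight (Suc n) (Suc (cell (Suc n) y)) \<le> height y' - height y"
      using height_bounds(2)[OF assms(1), of "Suc n"] height_bounds(1)[OF assms(2), of "Suc n"]
      unfolding cumulative_Suc by linarith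
    then show ?thesis
      using weight_adjacent(1)[of "Suc n" "cell (Suc n) y"] unfolding cell_weight_def by linarith
  next
    case False
    then have far: "cell (Suc n) y' + 2 \<le> cell (Suc n) y"
      using cell_of_far[OF assms(2), of y] assms(3) two by simp
    define k where "k = cell (Suc n) y - 1"
    have k: "cell (Suc n) y = Suc k" "Suc (cell (Suc n) y') \<le> k" using far by (auto simp: k_def)
    then have "cumulative (Suc n) (Suc (cell (Suc n) y')) \<le> cumulative (Suc n) k"
      by (intro cumulative_mono) simp
    then have "weight (Suc n) k \<le> height y - height y'"
      using height_bounds(2)[OF assms(2), of "Suc n"] height_bounds(1)[OF assms(1), of "Suc n"]
      unfolding k cumulative_Suc by linarith
    then show ?thesis
      using weight_adjacent(2)[of "Suc n" k] unfolding cell_weight_def k by linarith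
  qed
  moreover have "light * (light * cell_weight n y) \<le> light * cell_weight (Suc n) y"
    using cell_weight_Suc(2)[OF assms(1)] light by (intro mult_left_mono) auto
  ultimately show ?thesis by (simp add: power2_eq_square mult.assoc)
qed

end

section \<open>A positive measure of heights in cells of small mass\<close>

context scale_base
begin

text \<open>
  A bound for the fourth root of \<open>weight\<close>, with the mass of digit 1 rounded up to 1.
\<close>

primrec root_weight :: "nat \<Rightarrow> nat \<Rightarrow> real" where
  "root_weight 0 j = 1"
| "root_weight (Suc n) j = root_weight n (j div b) * (if j mod b = 1 then 1 else 1 / real b)"

lemma root_weight_pos: "0 < root_weight n j"
  using b49 by (induction n arbitrary: j) auto

lemma weight_le_root_weight: "weight n j \<le> root_weight n j ^ 4"
proof (induction n arbitrary: j)
  case (Suc n)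
  have "digit_weight (j mod b) \<le> (if j mod b = 1 then 1 else 1 / real b) ^ 4"
    using digit_weight_le_1[of 1] by (simp add: digit_weight_def light_def power_divide)
  then show ?case
    using Suc[of "j div b"] digit_weight(3)[of "j mod b"]
    unfolding weight.simps root_weight.simps power_mult_distrib
    by (intro mult_mono) auto
qed simp

text \<open>
  The sum over the digits is \<open>1 + (b - 1) / b\<close>.
\<close>

lemma sum_root_weight: "(\<Sum>j<b ^ n. root_weight n j) \<le> 2 ^ n"
proof (induction n)
  case (Suc n)
  have digits: "(\<Sum>d<b. if d = 1 then 1 else 1 / real b) \<le> 2"
  proof -
    have "(\<Sum>d<b. if d = 1 then 1 else 1 / real b) =
        1 + (\<Sum>d\<in>{..<b} - {1}. if d = 1 then 1 else 1 / real b)"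
      using b49 by (subst sum.remove[of _ 1]) auto
    also have "(\<Sum>d\<in>{..<b} - {1}. if d = 1 then 1 else 1 / real b) = (\<Sum>d\<in>{..<b} - {1}. 1 / real b)"
      by (intro sum.cong) auto
    also have "\<dots> = (real b - 1) / real b" using b49 by (simp add: of_nat_diff)
    also have "\<dots> \<le> 1" using b49 by simp
    finally show ?thesis by simp
  qed
  have "(\<Sum>j<b ^ Suc n. root_weight (Suc n) j) =
      (\<Sum>i<b ^ n. \<Sum>d<b. root_weight (Suc n) (b * i + d))"
    using sum_blocks[of "root_weight (Suc n)" "b ^ n"] by simp
  also have "\<dots> = (\<Sum>i<b ^ n. \<Sum>d<b. root_weight n i * (if d = 1 then 1 else 1 / real b))"
    using b49 by (intro sum.cong refl) simp
  also have "\<dots> = (\<Sum>i<b ^ n. root_weight n i) * (\<Sum>d<b. if d = 1 then 1 else 1 / real b)"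
    by (simp only: sum_distrib_left[symmetric] sum_distrib_right[symmetric])
  also have "\<dots> \<le> 2 ^ n * 2"
    using Suc digits by (intro mult_mono sum_nonneg) auto
  finally show ?case by simp
qed simp

definition heavy_cells :: "nat \<Rightarrow> nat set" where
  "heavy_cells n = {j. j < b ^ n \<and> 1 / real b ^ (2 * n) < weight n j}"

lemma finite_heavy_cells: "finite (heavy_cells n)"
  by (simp add: heavy_cells_def)

text \<open>
  Markov's inequality for the fourth roots: a heavy cell has a root of at least \<open>1 / c ^ n\<close>, while all
  roots together sum to at most \<open>2 ^ n\<close>. Among the \<open>b ^ n = c ^ (2 * n)\<close> cells the heavy ones are rare.
\<close>

lemma card_heavy_cells: "real (card (heavy_cells n)) \<le> (2 * real c) ^ n"
proof -
  have c: "0 < real c" using c7 by simp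
  have big: "1 / real c ^ n \<le> root_weight n j" if "j \<in> heavy_cells n" for j
  proof (rule ccontr)
    assume "\<not> 1 / real c ^ n \<le> root_weight n j"
    then have "root_weight n j ^ 4 \<le> (1 / real c ^ n) ^ 4"
      using root_weight_pos[of n j] by (intro power_mono) auto
    also have "\<dots> = 1 / real b ^ (2 * n)"
      by (simp add: b_eq power_divide power_mult[symmetric] mult.commute)
    finally show False
      using weight_le_root_weight[of n j] that by (simp add: heavy_cells_def)
  qed
  have "real (card (heavy_cells n)) * (1 / real c ^ n) = (\<Sum>j\<in>heavy_cells n. 1 / real c ^ n)"
    by simp
  also have "\<dots> \<le> (\<Sum>j\<in>heavy_cells n. root_weight n j)"
    using big by (rule sum_mono)
  also have "\<dots> \<le> (\<Sum>j<b ^ n. root_weight n j)"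
    by (rule sum_mono2) (auto simp: heavy_cells_def intro: less_imp_le[OF root_weight_pos])
  also have "\<dots> \<le> 2 ^ n" by (rule sum_root_weight)
  finally show ?thesis using c by (simp add: field_simps power_mult_distrib)
qed

definition heavy_region :: "nat \<Rightarrow> real set" where
  "heavy_region n = (\<Union>j\<in>heavy_cells n. {real j / real b ^ n..<(real j + 1) / real b ^ n})"

lemma heavy_region_borel: "heavy_region n \<in> sets borel"
  unfolding heavy_region_def using finite_heavy_cells by (intro sets.finite_UN) auto

lemma emeasure_heavy_region: "emeasure lborel (heavy_region n) \<le> ennreal ((2 / real c) ^ n)"
proof -
  have c: "0 < real c" using c7 by simp
  have "emeasure lborel (heavy_region n) \<le>
      (\<Sum>j\<in>heavy_cells n. emeasure lborel {real j / real b ^ n..<(real j + 1) / real b ^ n})"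
    unfolding heavy_region_def using finite_heavy_cells
    by (intro emeasure_subadditive_finite) auto
  also have "\<dots> = (\<Sum>j\<in>heavy_cells n. ennreal (1 / real b ^ n))"
  proof (rule sum.cong[OF refl])
    fix j :: nat
    have "real j / real b ^ n \<le> (real j + 1) / real b ^ n"
      by (simp add: divide_right_mono)
    then show "emeasure lborel {real j / real b ^ n..<(real j + 1) / real b ^ n} = ennreal (1 / real b ^ n)"
      by (simp add: add_divide_distrib)
  qed
  also have "\<dots> = ennreal (real (card (heavy_cells n)) * (1 / real b ^ n))"
    by (simp add: ennreal_of_nat_eq_real_of_nat ennreal_mult[symmetric])
  also have "\<dots> \<le> ennreal ((2 * real c) ^ n * (1 / real b ^ n))"
    using card_heavy_cells[of n] by (intro ennreal_leI mult_right_mono) auto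
  also have "(2 * real c) ^ n * (1 / real b ^ n) = (2 / real c) ^ n"
    using c by (simp add: b_eq power_divide power_mult_distrib power2_eq_square)
  finally show ?thesis .
qed

text \<open>
  The unique cell of level 0 has mass 1 and is never heavy, so the union may start at level 1.
\<close>

definition light_heights :: "real set" where
  "light_heights = {1/2..<1} - (\<Union>n. heavy_region (Suc n))"

lemma light_heights_borel: "light_heights \<in> sets borel"
  unfolding light_heights_def using heavy_region_borel by (intro sets.Diff sets.countable_UN) auto

lemma light_heights_range: "y \<in> light_heights \<Longrightarrow> 1/2 \<le> y \<and> y < 1"
  by (simp add: light_heights_def)

text \<open>
  The lengths of the heavy regions of the levels 1, 2, \<open>\<dots>\<close> sum to at most \<open>2/5\<close>, which is less than
  the length of \<open>[1/2, 1)\<close>.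
\<close>

lemma emeasure_light_heights: "0 < emeasure lborel light_heights"
proof -
  have "emeasure lborel (\<Union>n. heavy_region (Suc n)) \<le> (\<Sum>n. emeasure lborel (heavy_region (Suc n)))"
    using heavy_region_borel by (intro emeasure_subadditive_countably) auto
  also have "\<dots> \<le> (\<Sum>n. ennreal (2/7 * (2/7) ^ n))"
  proof (intro suminf_le allI)
    fix n
    have "(2 / real c) ^ Suc n \<le> (2/7) ^ Suc n"
      using c7 by (intro power_mono) (auto simp: field_simps)
    then show "emeasure lborel (heavy_region (Suc n)) \<le> ennreal (2/7 * (2/7) ^ n)"
      using emeasure_heavy_region[of "Suc n"] by (metis ennreal_leI order_trans power_Suc)
  qed auto
  also have "\<dots> = ennreal (2/5)"
  proof (rule suminf_ennreal_eq)
    show "(\<lambda>n. 2/7 * (2/7) ^ n) sums (2/5 :: real)"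
      using sums_mult[OF geometric_sums[of "2/7 :: real"], of "2/7"] by simp
  qed simp
  finally have heavy: "emeasure lborel (\<Union>n. heavy_region (Suc n)) \<le> ennreal (2/5)" .
  show ?thesis
  proof (rule ccontr)
    assume "\<not> 0 < emeasure lborel light_heights"
    then have 0: "emeasure lborel light_heights = 0" by simp
    have "ennreal (1/2) = emeasure lborel {1/2..<1::real}" by simp
    also have "\<dots> \<le> emeasure lborel (light_heights \<union> (\<Union>n. heavy_region (Suc n)))"
      using light_heights_borel heavy_region_borel
      by (intro emeasure_mono sets.Un sets.countable_UN) (auto simp: light_heights_def)
    also have "\<dots> \<le> emeasure lborel light_heights + emeasure lborel (\<Union>n. heavy_region (Suc n))"
      using light_heights_borel heavy_region_borel
      by (intro emeasure_subadditive sets.countable_UN) auto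
    also have "\<dots> \<le> ennreal (2/5)" using heavy 0 by simp
    finally have "(1/2 :: real) \<le> 2/5"
      by (subst (asm) ennreal_le_iff) auto
    then show False by simp
  qed
qed

lemma cell_weight_light_heights:
  assumes "y \<in> light_heights"
  shows "cell_weight n y \<le> 1 / real b ^ (2 * n)"
proof (cases n)
  case 0
  then show ?thesis by (simp add: cell_weight_def)
next
  case (Suc m)
  have y: "0 \<le> y" "y < 1" using light_heights_range[OF assms] by auto
  have "y \<in> {real (cell n y) / real b ^ n..<(real (cell n y) + 1) / real b ^ n}"
    using cell_bounds[OF y(1), of n] b49 by (simp add: field_simps)
  moreover have "y \<notin> heavy_region n" using assms Suc by (auto simp: light_heights_def)
  ultimately have "cell n y \<notin> heavy_cells n" unfolding heavy_region_def by blast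
  then show ?thesis
    using cell_less_power[OF y, of n] by (simp add: heavy_cells_def cell_weight_def)
qed

end

section \<open>A Cantor set and the bridge distance\<close>

context scale_base
begin

definition cantor :: "real set" where
  "cantor = {x. 0 \<le> x \<and> x < 1 \<and> (\<forall>n. cell (Suc n) x mod b \<noteq> b - 1)}"

text \<open>
  As the digit \<open>b - 1\<close> is missing, the last subinterval of each cell contains no point of the
  Cantor set.
\<close>

lemma cantor_separation:
  assumes "x \<in> cantor" "x' \<in> cantor" "cell n x \<noteq> cell n x'"
  shows "1 / real b ^ Suc n \<le> \<bar>x - x'\<bar>"
proof -
  have *: "1 / real b ^ Suc n \<le> x' - x"
    if "x \<in> cantor" "x' \<in> cantor" "cell n x < cell n x'" for x x'
  proof -
    have x: "0 \<le> x" "0 \<le> x'" "cell (Suc n) x mod b \<noteq> b - 1"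
      using that by (auto simp: cantor_def)
    have "cell (Suc n) x mod b < b" using b49 by simp
    then have "cell (Suc n) x + 2 \<le> b * cell n x + b"
      using x(3) cell_Suc[OF x(1), of n] by linarith
    also have "\<dots> = b * (cell n x + 1)" by simp
    also have "\<dots> \<le> b * cell n x'" using that(3) by (intro mult_left_mono) auto
    also have "\<dots> \<le> cell (Suc n) x'" using cell_Suc[OF x(2), of n] by linarith
    finally have "real (cell (Suc n) x) + 2 \<le> real (cell (Suc n) x')" by linarith
    then have "1 \<le> real b ^ Suc n * (x' - x)"
      using cell_bounds[OF x(1), of "Suc n"] cell_bounds[OF x(2), of "Suc n"]
      by (simp add: right_diff_distrib)
    then show ?thesis using b49 by (simp add: field_simps)
  qed
  show ?thesis
  proof (cases "cell n x < cell n x'")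
    case True
    then show ?thesis using *[OF assms(1,2)] by linarith
  next
    case False
    then show ?thesis using *[OF assms(2,1)] assms(3) by linarith
  qed
qed

lemma cantor_same_cell:
  assumes "x \<in> cantor" "x' \<in> cantor" "\<bar>x - x'\<bar> \<le> 1 / real b ^ m"
  shows "cell (m - 2) x = cell (m - 2) x'"
proof (cases "m \<le> 1")
  case True
  then show ?thesis using assms(1,2) cell_0 by (simp add: cantor_def)
next
  case False
  then obtain k where k: "m = Suc (Suc k)" by (metis One_nat_def Suc_le_mono not_less_eq_eq old.nat.exhaust zero_le)
  have "1 / real b ^ m < 1 / real b ^ Suc k"
    using b49 k by (simp add: field_simps)
  then show ?thesis
    using cantor_separation[OF assms(1,2), of k] assms(3) k by fastforce
qed

lemma card_cantor_cells:
  "finite (cell n ` cantor) \<and> card (cell n ` cantor) \<le> (b - 1) ^ n"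
proof (induction n)
  case 0
  have "cell 0 ` cantor \<subseteq> {0}" using cell_0 by (auto simp: cantor_def)
  then have "card (cell 0 ` cantor) \<le> card {0::nat}" by (intro card_mono) auto
  then show ?case using \<open>cell 0 ` cantor \<subseteq> {0}\<close> finite_subset by auto
next
  case (Suc n)
  let ?f = "\<lambda>(k, d). b * k + d" and ?A = "cell n ` cantor \<times> {..<b - 1}"
  have "cell (Suc n) ` cantor \<subseteq> ?f ` ?A"
  proof
    fix k assume "k \<in> cell (Suc n) ` cantor"
    then obtain x where x: "x \<in> cantor" "k = cell (Suc n) x" by auto
    have "cell (Suc n) x mod b < b" using b49 by simp
    moreover have "cell (Suc n) x mod b \<noteq> b - 1" "0 \<le> x" using x by (auto simp: cantor_def)
    ultimately have "cell (Suc n) x mod b < b - 1" "k = b * cell n x + cell (Suc n) x mod b"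
      using x(2) cell_Suc[of x n] by auto
    then show "k \<in> ?f ` ?A" using x(1) by (intro image_eqI[of _ _ "(cell n x, cell (Suc n) x mod b)"]) auto
  qed
  moreover have fin: "finite ?A" using Suc by auto
  ultimately have "card (cell (Suc n) ` cantor) \<le> card (?f ` ?A)" "finite (cell (Suc n) ` cantor)"
    by (simp_all only: card_mono finite_subset finite_imageI)
  moreover have "card (?f ` ?A) \<le> card ?A" using fin by (rule card_image_le)
  moreover have "card ?A \<le> (b - 1) ^ Suc n" using Suc by (simp add: card_cartesian_product mult.commute)
  ultimately show ?case by linarith
qed

text \<open>
  The costs of the paths from \<open>p\<close> to \<open>q\<close> that move vertically to a height \<open>z\<close>, jump horizontally
  inside a common cell of level \<open>n\<close> at a price equal to the mass of the cell of \<open>z\<close>, and move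
  vertically again. Level 0 is always allowed, which makes the set nonempty for all \<open>p\<close> and \<open>q\<close>.
\<close>

definition bridge_costs :: "real \<times> real \<Rightarrow> real \<times> real \<Rightarrow> real set" where
  "bridge_costs p q = {\<bar>height (snd p) - height z\<bar> + \<bar>height z - height (snd q)\<bar> + cell_weight n z | n z.
     0 \<le> z \<and> (n = 0 \<or> cell n (fst p) = cell n (fst q))}"

definition bridge_dist :: "real \<times> real \<Rightarrow> real \<times> real \<Rightarrow> real" where
  "bridge_dist p q = Inf (bridge_costs p q)"

lemma bridge_costs_nonempty: "bridge_costs p q \<noteq> {}"
  unfolding bridge_costs_def by (auto intro!: exI[of _ "0::real"])

lemma bridge_costsI:
  assumes "0 \<le> z" "n = 0 \<or> cell n (fst p) = cell n (fst q)"
  shows "\<bar>height (snd p) - height z\<bar> + \<bar>height z - height (snd q)\<bar> + cell_weight n z \<in> bridge_costs p q"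
  unfolding bridge_costs_def using assms by blast

lemma bridge_costsE:
  assumes "v \<in> bridge_costs p q"
  obtains n z where "0 \<le> z" "n = 0 \<or> cell n (fst p) = cell n (fst q)"
    "v = \<bar>height (snd p) - height z\<bar> + \<bar>height z - height (snd q)\<bar> + cell_weight n z"
  using assms unfolding bridge_costs_def by blast

lemma bridge_costs_nonneg: "v \<in> bridge_costs p q \<Longrightarrow> 0 \<le> v"
  using less_imp_le[OF cell_weight_pos] by (elim bridge_costsE) simp

lemma bridge_dist_le:
  assumes "v \<in> bridge_costs p q"
  shows "bridge_dist p q \<le> v"
  unfolding bridge_dist_def
  using assms by (rule cInf_lower) (rule bdd_belowI[of _ 0], rule bridge_costs_nonneg)

lemma bridge_dist_ge:
  assumes "\<And>v. v \<in> bridge_costs p q \<Longrightarrow> L \<le> v"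
  shows "L \<le> bridge_dist p q"
  unfolding bridge_dist_def using assms bridge_costs_nonempty by (intro cInf_greatest) auto

lemma bridge_dist_nonneg: "0 \<le> bridge_dist p q"
  using bridge_costs_nonneg by (rule bridge_dist_ge)

lemma bridge_dist_commute: "bridge_dist p q = bridge_dist q p"
proof -
  have "bridge_costs p q \<subseteq> bridge_costs q p" for p q
  proof
    fix v assume "v \<in> bridge_costs p q"
    then obtain n z where *: "0 \<le> z" "n = 0 \<or> cell n (fst p) = cell n (fst q)"
      "v = \<bar>height (snd p) - height z\<bar> + \<bar>height z - height (snd q)\<bar> + cell_weight n z"
      by (rule bridge_costsE)
    have "v = \<bar>height (snd q) - height z\<bar> + \<bar>height z - height (snd p)\<bar> + cell_weight n z"
      using *(3) by (simp add: abs_minus_commute)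
    then show "v \<in> bridge_costs q p" using bridge_costsI[of z n q p] * by auto
  qed
  then have "bridge_costs p q = bridge_costs q p" by blast
  then show ?thesis by (simp add: bridge_dist_def)
qed

lemma height_le_bridge_dist: "\<bar>height (snd p) - height (snd q)\<bar> \<le> bridge_dist p q"
proof (rule bridge_dist_ge)
  fix v assume "v \<in> bridge_costs p q"
  then obtain n z where *: "0 \<le> z" "n = 0 \<or> cell n (fst p) = cell n (fst q)"
    "v = \<bar>height (snd p) - height z\<bar> + \<bar>height z - height (snd q)\<bar> + cell_weight n z"
    by (rule bridge_costsE)
  then show "\<bar>height (snd p) - height (snd q)\<bar> \<le> v" using cell_weight_pos[of n z] by linarith
qed

text \<open>
  Of two jumps only the one at the coarser level is needed, as it already leads from the first
  point to the cell of the last one; the height difference along the other path is at most the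
  cost of that path.
\<close>

lemma bridge_dist_triangle:
  assumes "0 \<le> fst p" "0 \<le> fst q" "0 \<le> fst r"
  shows "bridge_dist p r \<le> bridge_dist p q + bridge_dist q r"
proof -
  have sum: "bridge_dist p r \<le> v + w" if v: "v \<in> bridge_costs p q" and w: "w \<in> bridge_costs q r" for v w
  proof -
    obtain n z where 1: "0 \<le> z" "n = 0 \<or> cell n (fst p) = cell n (fst q)"
      "v = \<bar>height (snd p) - height z\<bar> + \<bar>height z - height (snd q)\<bar> + cell_weight n z"
      using v by (rule bridge_costsE)
    obtain n' z' where 2: "0 \<le> z'" "n' = 0 \<or> cell n' (fst q) = cell n' (fst r)"
      "w = \<bar>height (snd q) - height z'\<bar> + \<bar>height z' - height (snd r)\<bar> + cell_weight n' z'"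
      using w by (rule bridge_costsE)
    show ?thesis
    proof (cases "n \<le> n'")
      case True
      have "n = 0 \<or> cell n (fst p) = cell n (fst r)"
        using 1(2) 2(2) True cell_eq_mono[OF assms(2,3), of n' n] by auto
      then have "bridge_dist p r \<le> \<bar>height (snd p) - height z\<bar> + \<bar>height z - height (snd r)\<bar> + cell_weight n z"
        using 1(1) by (intro bridge_dist_le bridge_costsI) auto
      then show ?thesis using 1(3) 2(3) cell_weight_pos[of n' z'] by linarith
    next
      case False
      then have "n' = 0 \<or> cell n' (fst p) = cell n' (fst r)"
        using 1(2) 2(2) cell_eq_mono[OF assms(1,2), of n n'] by auto
      then have "bridge_dist p r \<le> \<bar>height (snd p) - height z'\<bar> + \<bar>height z' - height (snd r)\<bar> + cell_weight n' z'"
        using 2(1) by (intro bridge_dist_le bridge_costsI) auto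
      then show ?thesis using 1(3) 2(3) cell_weight_pos[of n z] by linarith
    qed
  qed
  have "bridge_dist p r - w \<le> bridge_dist p q" if "w \<in> bridge_costs q r" for w
    using sum[OF _ that] by (intro bridge_dist_ge) (simp add: diff_le_eq)
  then have "bridge_dist p r - bridge_dist p q \<le> bridge_dist q r"
    by (intro bridge_dist_ge) (simp add: algebra_simps)
  then show ?thesis by simp
qed

lemma bridge_dist_self:
  assumes "0 \<le> snd p"
  shows "bridge_dist p p = 0"
proof -
  have "bridge_dist p p \<le> cell_weight n (snd p)" for n
    using bridge_dist_le[OF bridge_costsI[OF assms, of n p p]] by simp
  then have "bridge_dist p p \<le> 0"
    by (intro LIMSEQ_le_const[OF cell_weight_tendsto_0[OF assms]]) auto
  then show ?thesis using bridge_dist_nonneg[of p p] by simp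
qed

text \<open>
  The path that jumps at the height of \<open>p\<close>. Points of the Cantor set at distance at most \<open>1 / b ^ m\<close>
  share a cell of level \<open>m - 2\<close>, whose mass exceeds that of level \<open>m\<close> by a bounded factor.
\<close>

lemma bridge_dist_upper:
  assumes p: "fst p \<in> cantor" "0 \<le> snd p" and q: "fst q \<in> cantor" "0 \<le> snd q"
    and "\<bar>fst p - fst q\<bar> \<le> 1 / real b ^ m" "\<bar>snd p - snd q\<bar> \<le> 1 / real b ^ m"
  shows "bridge_dist p q \<le> 3 / light\<^sup>2 * cell_weight m (snd p)"
proof -
  define V where "V n = cell_weight n (snd p)" for n
  have step: "light * V n \<le> V (Suc n)" for n
    using cell_weight_Suc(2)[OF p(2)] by (simp add: V_def)
  have V: "0 < V n" for n by (simp add: V_def cell_weight_pos)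
  have two: "light\<^sup>2 * V (m - 2) \<le> V m"
  proof -
    consider "m = 0" | "m = 1" | k where "m = Suc (Suc k)" by (metis One_nat_def old.nat.exhaust)
    then show ?thesis
    proof cases
      case 1
      have "light\<^sup>2 * V m \<le> 1 * V m"
        using light V[of m] by (intro mult_right_mono) (auto simp: power_le_one)
      then show ?thesis using 1 by simp
    next
      case 2
      have "light * (light * V 0) \<le> 1 * (light * V 0)"
        using light V[of 0] by (intro mult_right_mono) auto
      then show ?thesis using 2 step[of 0] by (simp add: power2_eq_square mult.assoc)
    next
      case (3 k)
      have "light * (light * V k) \<le> light * V (Suc k)"
        using step[of k] light by (intro mult_left_mono) auto
      then show ?thesis using 3 step[of "Suc k"] by (simp add: power2_eq_square mult.assoc)
    qed
  qed
  have "cell (m - 2) (fst p) = cell (m - 2) (fst q)"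
    using cantor_same_cell[OF p(1) q(1)] assms(5) .
  then have "bridge_dist p q \<le> \<bar>height (snd p) - height (snd q)\<bar> + V (m - 2)"
    using bridge_dist_le[OF bridge_costsI[OF p(2), of "m - 2" p q]] by (simp add: V_def)
  also have "\<dots> \<le> 2 / light * V m + V m / light\<^sup>2"
  proof -
    have "V (m - 2) \<le> V m / light\<^sup>2" using two light by (simp add: field_simps)
    then show ?thesis using height_close(1)[OF p(2) q(2) assms(6)] by (simp add: V_def)
  qed
  also have "\<dots> \<le> 2 / light\<^sup>2 * V m + V m / light\<^sup>2"
  proof -
    have "2 / light \<le> 2 / light\<^sup>2"
      using light by (intro divide_left_mono) (auto simp: power2_eq_square mult_left_le_one_le)
    then show ?thesis using V[of m] by (intro add_right_mono mult_right_mono) auto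
  qed
  also have "\<dots> = 3 / light\<^sup>2 * V m" by (simp add: field_simps)
  finally show ?thesis by (simp add: V_def)
qed

text \<open>
  If \<open>p\<close> and \<open>q\<close> are far apart vertically, the height difference is large. If they are far apart
  horizontally, then the jump is at a level \<open>n \<le> m\<close>, and either it takes place near the height of \<open>p\<close>,
  where its price is comparable to the mass at \<open>p\<close>, or the path first travels far vertically.
\<close>

lemma bridge_dist_lower:
  assumes p: "fst p \<in> cantor" "0 \<le> snd p" and q: "fst q \<in> cantor" "0 \<le> snd q"
    and far: "1 / real b ^ m / 2 \<le> \<bar>fst p - fst q\<bar> \<or> 1 / real b ^ m / 2 \<le> \<bar>snd p - snd q\<bar>"
  shows "light\<^sup>2 * cell_weight m (snd p) \<le> bridge_dist p q"
proof (cases "1 / real b ^ m / 2 \<le> \<bar>snd p - snd q\<bar>")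
  case True
  then show ?thesis using height_far[OF p(2) q(2)] height_le_bridge_dist[of p q] by fastforce
next
  case False
  then have x: "1 / real b ^ m / 2 \<le> \<bar>fst p - fst q\<bar>" using far by blast
  have b: "49 \<le> real b" using b49 by simp
  have fst0: "0 \<le> fst p" "0 \<le> fst q" "fst p < 1" "fst q < 1"
    using p q by (auto simp: cantor_def)
  show ?thesis
  proof (rule bridge_dist_ge)
    fix v assume "v \<in> bridge_costs p q"
    then obtain n z where *: "0 \<le> z" "n = 0 \<or> cell n (fst p) = cell n (fst q)"
      "v = \<bar>height (snd p) - height z\<bar> + \<bar>height z - height (snd q)\<bar> + cell_weight n z"
      by (rule bridge_costsE)
    have "cell n (fst p) = cell n (fst q)" using *(2) cell_0 fst0 by auto
    then have "\<bar>fst p - fst q\<bar> < 1 / real b ^ n" by (rule cell_eq_imp_close[OF fst0(1,2)])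
    then have "1 / real b ^ m / 2 < 1 / real b ^ n" by (rule order_le_less_trans[OF x])
    then have close: "real b ^ n < 2 * real b ^ m" using b by (simp add: field_simps)
    have "n \<le> m"
    proof (rule ccontr)
      assume "\<not> n \<le> m"
      then have "real b ^ Suc m \<le> real b ^ n" using b by (intro power_increasing) auto
      moreover have "2 * real b ^ m \<le> real b * real b ^ m" using b by (intro mult_right_mono) auto
      ultimately show False using close by simp
    qed
    then have "cell_weight m z \<le> cell_weight n z" using cell_weight_antimono *(1) by blast
    moreover have "light\<^sup>2 * cell_weight m (snd p) \<le> \<bar>height (snd p) - height z\<bar> + cell_weight m z"
    proof (cases "\<bar>snd p - z\<bar> \<le> 1 / real b ^ m")
      case True
      have "light * (light * cell_weight m (snd p)) \<le> 1 * (light * cell_weight m (snd p))"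
        using light cell_weight_pos[of m] by (intro mult_right_mono) (auto intro: less_imp_le)
      then show ?thesis using height_close(2)[OF p(2) *(1) True]
        by (simp add: power2_eq_square mult.assoc)
    next
      case False
      then have "1 / real b ^ m \<le> \<bar>snd p - z\<bar>" by simp
      moreover have "1 / real b ^ m / 2 \<le> 1 / real b ^ m" using b by (simp add: field_simps)
      ultimately have "1 / real b ^ m / 2 \<le> \<bar>snd p - z\<bar>" by (rule order_trans[rotated])
      then show ?thesis using height_far[OF p(2) *(1)] cell_weight_pos[of m z] by fastforce
    qed
    ultimately show "light\<^sup>2 * cell_weight m (snd p) \<le> v" using *(3) by linarith
  qed
qed

end

section \<open>The distorted metric\<close>

context scale_base
begin

text \<open>
  The places at which the graph is allowed to have points: the horizontal piece, and the product
  of the Cantor set with the heights in cells of small mass.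
\<close>

definition admissible :: "real \<times> real \<Rightarrow> bool" where
  "admissible p \<longleftrightarrow> snd p = 0 \<and> 0 \<le> fst p \<and> fst p \<le> 1 \<or> fst p \<in> cantor \<and> snd p \<in> light_heights"

lemma admissibleE:
  assumes "admissible p"
  obtains "snd p = 0" "0 \<le> fst p" "fst p \<le> 1"
  | "snd p \<noteq> 0" "fst p \<in> cantor" "snd p \<in> light_heights" "0 \<le> fst p" "fst p < 1" "1/2 \<le> snd p" "snd p < 1"
  using assms light_heights_range[of "snd p"] unfolding admissible_def cantor_def by force

text \<open>
  An upper bound for the bridge distance of points in the product. It serves as the distance
  between the two pieces, which are far apart in both metrics.
\<close>

definition cross_dist :: real where "cross_dist = 3 / light\<^sup>2"

lemma cross_dist_ge_1: "1 \<le> cross_dist"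
proof -
  have "light\<^sup>2 \<le> 1" using light by (simp add: power_le_one)
  then show ?thesis using light by (simp add: cross_dist_def field_simps)
qed

definition graph_dist :: "real \<times> real \<Rightarrow> real \<times> real \<Rightarrow> real" where
  "graph_dist p q =
     (if snd p = 0 \<and> snd q = 0 then \<bar>fst p - fst q\<bar>
      else if snd p \<noteq> 0 \<and> snd q \<noteq> 0 then bridge_dist p q
      else cross_dist)"

lemma bridge_dist_le_cross_dist:
  assumes "fst p \<in> cantor" "snd p \<in> light_heights" "fst q \<in> cantor" "snd q \<in> light_heights"
  shows "bridge_dist p q \<le> cross_dist"
proof -
  have "\<bar>fst p - fst q\<bar> \<le> 1" "\<bar>snd p - snd q\<bar> \<le> 1"
    using assms light_heights_range[of "snd p"] light_heights_range[of "snd q"] by (auto simp: cantor_def)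
  then have "bridge_dist p q \<le> 3 / light\<^sup>2 * cell_weight 0 (snd p)"
    using assms light_heights_range[of "snd p"] light_heights_range[of "snd q"]
    by (intro bridge_dist_upper) auto
  then show ?thesis by (simp add: cross_dist_def cell_weight_def)
qed

text \<open>
  The size of the scale \<open>1 / b ^ n\<close> at \<open>p\<close> in the distorted metric.
\<close>

definition scale_size :: "real \<times> real \<Rightarrow> nat \<Rightarrow> real" where
  "scale_size p n = (if snd p = 0 then 1 / real b ^ n else cell_weight n (snd p))"

definition distortion :: real where "distortion = 3 / light ^ 3"

lemma distortion: "real b \<le> distortion" "3 \<le> distortion" "cross_dist \<le> distortion" "1 / light ^ 3 \<le> distortion"
proof -
  have l: "0 < light" "light \<le> 1" using light by auto
  have "light ^ 3 \<le> light ^ 1" using l by (intro power_decreasing) auto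
  then have "real b * light ^ 3 \<le> real b * light" by (intro mult_left_mono) auto
  then have "real b * light ^ 3 \<le> 3" using light(3) by linarith
  then show "real b \<le> distortion" using l by (simp add: distortion_def field_simps)
  have "light ^ 3 \<le> 1" using l by (simp add: power_le_one)
  then show "3 \<le> distortion" using l by (simp add: distortion_def field_simps)
  have "light ^ 3 \<le> light ^ 2" using l by (intro power_decreasing) auto
  then show "cross_dist \<le> distortion" using l unfolding cross_dist_def distortion_def
    by (intro divide_left_mono) auto
  show "1 / light ^ 3 \<le> distortion" using l unfolding distortion_def
    by (intro divide_right_mono) auto
qed

text \<open>
  The level \<open>n\<close> is the one of the maximum of the two coordinate differences. For points in different
  pieces it is 0, because their heights differ by at least one half.
\<close>

lemma graph_dist_comparable:
  assumes "admissible p" "admissible q" "p \<noteq> q"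
  shows "\<exists>n. dist p q \<le> distortion / real b ^ n \<and> 1 / real b ^ n \<le> distortion * dist p q \<and>
      graph_dist p q \<le> distortion * scale_size p n \<and> scale_size p n \<le> distortion * graph_dist p q"
proof -
  have b: "49 \<le> real b" using b49 by simp
  define \<sigma> where "\<sigma> = max \<bar>fst p - fst q\<bar> \<bar>snd p - snd q\<bar>"
  have \<sigma>: "0 < \<sigma>" "\<sigma> \<le> 1"
  proof -
    show "0 < \<sigma>" using assms(3) by (auto simp: \<sigma>_def prod_eq_iff less_max_iff_disj)
    show "\<sigma> \<le> 1" using assms(1,2) by (elim admissibleE) (auto simp: \<sigma>_def)
  qed
  have dist: "\<sigma> \<le> dist p q" "dist p q \<le> 2 * \<sigma>"
  proof -
    show "\<sigma> \<le> dist p q"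
      using dist_fst_le[of p q] dist_snd_le[of p q] by (simp add: \<sigma>_def dist_real_def)
    have "dist p q \<le> \<bar>fst p - fst q\<bar> + \<bar>snd p - snd q\<bar>"
      using sqrt_sum_squares_le_sum_abs[of "fst p - fst q" "snd p - snd q"]
      by (simp add: dist_prod_def dist_real_def)
    moreover have "\<bar>fst p - fst q\<bar> \<le> \<sigma>" "\<bar>snd p - snd q\<bar> \<le> \<sigma>" by (auto simp: \<sigma>_def)
    ultimately show "dist p q \<le> 2 * \<sigma>" by linarith
  qed
  obtain n where n: "1 / real b ^ Suc n < \<sigma>" "\<sigma> \<le> 1 / real b ^ n"
    using exists_scale[of "real b" \<sigma>] \<sigma> b by auto
  have 1: "dist p q \<le> distortion / real b ^ n"
  proof -
    have "dist p q \<le> 3 * \<sigma>" using dist \<sigma> by linarith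
    also have "\<dots> \<le> distortion * (1 / real b ^ n)"
      using n(2) \<sigma> distortion(2) by (intro mult_mono) auto
    finally show ?thesis by simp
  qed
  have bn: "1 / real b ^ n \<le> real b * \<sigma>" using n(1) b by (simp add: field_simps)
  have 2: "1 / real b ^ n \<le> distortion * dist p q"
  proof -
    have "real b * \<sigma> \<le> distortion * dist p q"
      using distortion(1) dist(1) \<sigma>(1) b by (intro mult_mono) auto
    then show ?thesis using bn by (rule order_trans[rotated])
  qed
  consider (base) "snd p = 0" "snd q = 0" | (upper) "snd p \<noteq> 0" "snd q \<noteq> 0"
    | (mixed) "snd p = 0 \<longleftrightarrow> snd q \<noteq> 0" by blast
  then have "graph_dist p q \<le> distortion * scale_size p n \<and> scale_size p n \<le> distortion * graph_dist p q"
  proof cases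
    case base
    then have e: "graph_dist p q = \<sigma>" "scale_size p n = 1 / real b ^ n"
      by (auto simp: graph_dist_def \<sigma>_def scale_size_def)
    have "1 * \<sigma> \<le> distortion * (1 / real b ^ n)"
      using n(2) \<sigma> distortion(2) by (intro mult_mono) auto
    moreover have "real b * \<sigma> \<le> distortion * \<sigma>" using distortion(1) \<sigma> by simp
    ultimately show ?thesis unfolding e using bn by linarith
  next
    case upper
    then have pq: "fst p \<in> cantor" "0 \<le> snd p" "fst q \<in> cantor" "0 \<le> snd q"
      using assms(1,2) by (auto elim!: admissibleE)
    have e: "graph_dist p q = bridge_dist p q" "scale_size p n = cell_weight n (snd p)"
      using upper by (auto simp: graph_dist_def scale_size_def)
    have "bridge_dist p q \<le> cross_dist * cell_weight n (snd p)"
      unfolding cross_dist_def using n(2) pq by (intro bridge_dist_upper) (auto simp: \<sigma>_def)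
    also have "\<dots> \<le> distortion * cell_weight n (snd p)"
      using distortion(3) cell_weight_pos[of n "snd p"] by (intro mult_right_mono) auto
    finally have "bridge_dist p q \<le> distortion * cell_weight n (snd p)" .
    moreover have "cell_weight n (snd p) \<le> distortion * bridge_dist p q"
    proof -
      have "1 / real b ^ Suc n / 2 \<le> 1 / real b ^ Suc n" using b by (simp add: field_simps)
      also have "\<dots> \<le> \<sigma>" using n(1) by simp
      finally have "light\<^sup>2 * cell_weight (Suc n) (snd p) \<le> bridge_dist p q"
        using pq by (intro bridge_dist_lower) (auto simp: \<sigma>_def le_max_iff_disj)
      moreover have "light\<^sup>2 * (light * cell_weight n (snd p)) \<le> light\<^sup>2 * cell_weight (Suc n) (snd p)"
        using cell_weight_Suc(2)[OF pq(2)] by (intro mult_left_mono) auto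
      ultimately have "light ^ 3 * cell_weight n (snd p) \<le> bridge_dist p q"
        by (simp add: power3_eq_cube power2_eq_square mult.assoc)
      then have "cell_weight n (snd p) \<le> 1 / light ^ 3 * bridge_dist p q"
        using light by (simp add: field_simps)
      also have "\<dots> \<le> distortion * bridge_dist p q"
        using distortion(4) bridge_dist_nonneg by (intro mult_right_mono) auto
      finally show ?thesis .
    qed
    ultimately show ?thesis unfolding e by blast
  next
    case mixed
    have "1/2 \<le> \<bar>snd p - snd q\<bar>" using mixed assms(1,2) by (elim admissibleE) auto
    then have "1/2 \<le> \<sigma>" unfolding \<sigma>_def by (rule order_trans[OF _ max.cobounded2])
    have "n = 0"
    proof (rule ccontr)
      assume "n \<noteq> 0"
      then have "real b ^ 1 \<le> real b ^ n" using b by (intro power_increasing) auto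
      then have "3 \<le> real b ^ n" using b unfolding power_one_right by linarith
      then have "1 / real b ^ n \<le> 1 / 3" using b by (intro divide_left_mono) auto
      then show False using n(2) \<open>1/2 \<le> \<sigma>\<close> by linarith
    qed
    then have e: "graph_dist p q = cross_dist" "scale_size p n = 1"
      using mixed by (auto simp: graph_dist_def scale_size_def cell_weight_def)
    have "1 * 1 \<le> distortion * cross_dist" using distortion(2) cross_dist_ge_1 by (intro mult_mono) auto
    then show ?thesis unfolding e using distortion(3) by simp
  qed
  then show ?thesis using 1 2 by blast
qed

lemma scale_size:
  assumes "admissible p"
  shows "0 < scale_size p n" "scale_size p (Suc n) \<le> (1 - light) * scale_size p n"
    "light * scale_size p n \<le> scale_size p (Suc n)"
proof -
  have b: "49 \<le> real b" using b49 by simp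
  have "0 < scale_size p n \<and> scale_size p (Suc n) \<le> (1 - light) * scale_size p n \<and>
    light * scale_size p n \<le> scale_size p (Suc n)"
  proof (cases "snd p = 0")
    case True
    have "1 / real b \<le> 1 / 2" using b by (intro divide_left_mono) auto
    then have "1 / real b \<le> 1 - light" using light(4) by linarith
    then have "1 / real b * (1 / real b ^ n) \<le> (1 - light) * (1 / real b ^ n)"
      by (intro mult_right_mono) auto
    moreover have "light \<le> 1 / real b" using light(3) b by (simp add: field_simps)
    then have "light * (1 / real b ^ n) \<le> 1 / real b * (1 / real b ^ n)"
      by (intro mult_right_mono) auto
    ultimately show ?thesis using True b by (simp add: scale_size_def)
  next
    case False
    then have "0 \<le> snd p" using assms by (auto elim!: admissibleE)
    then show ?thesis using False cell_weight_Suc cell_weight_pos by (simp add: scale_size_def)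
  qed
  then show "0 < scale_size p n" "scale_size p (Suc n) \<le> (1 - light) * scale_size p n"
    "light * scale_size p n \<le> scale_size p (Suc n)" by auto
qed

lemma graph_dist_commute: "graph_dist p q = graph_dist q p"
  by (auto simp: graph_dist_def bridge_dist_commute abs_minus_commute)

lemma graph_dist_nonneg: "0 \<le> graph_dist p q"
  using cross_dist_ge_1 by (simp add: graph_dist_def bridge_dist_nonneg)

lemma graph_dist_triangle:
  assumes "admissible p" "admissible q" "admissible r"
  shows "graph_dist p r \<le> graph_dist p q + graph_dist q r"
proof -
  have le_cross_dist: "graph_dist p q \<le> cross_dist" if "admissible p" "admissible q" for p q
    using that cross_dist_ge_1 bridge_dist_le_cross_dist by (elim admissibleE) (auto simp: graph_dist_def)
  have eq_cross_dist: "graph_dist p q = cross_dist" if "snd p = 0 \<longleftrightarrow> snd q \<noteq> 0" for p q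
    using that by (auto simp: graph_dist_def)
  show ?thesis
  proof (cases "(snd p = 0 \<longleftrightarrow> snd q \<noteq> 0) \<or> (snd q = 0 \<longleftrightarrow> snd r \<noteq> 0)")
    case True
    then have "graph_dist p q = cross_dist \<or> graph_dist q r = cross_dist" using eq_cross_dist by blast
    then show ?thesis
      using le_cross_dist[OF assms(1,3)] graph_dist_nonneg[of p q] graph_dist_nonneg[of q r] by linarith
  next
    case False
    show ?thesis
    proof (cases "snd q = 0")
      case True
      then show ?thesis using False by (auto simp: graph_dist_def)
    next
      case q: False
      then have "snd p \<noteq> 0" "snd r \<noteq> 0" using False by auto
      moreover have "0 \<le> fst p" "0 \<le> fst q" "0 \<le> fst r" using assms by (auto elim!: admissibleE)
      ultimately show ?thesis using q bridge_dist_triangle by (simp add: graph_dist_def)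
    qed
  qed
qed

lemma metric_space_graph_dist: "Metric_space (Collect admissible) graph_dist"
proof
  show "0 \<le> graph_dist p q" for p q by (rule graph_dist_nonneg)
  show "graph_dist p q = graph_dist q p" for p q by (rule graph_dist_commute)
  show "graph_dist p q = 0 \<longleftrightarrow> p = q" if pq: "p \<in> Collect admissible" "q \<in> Collect admissible" for p q
  proof
    assume "graph_dist p q = 0"
    show "p = q"
    proof (rule ccontr)
      assume "p \<noteq> q"
      then obtain n where "scale_size p n \<le> distortion * graph_dist p q"
        using graph_dist_comparable[of p q] pq by auto
      then show False using \<open>graph_dist p q = 0\<close> scale_size(1)[of p n] pq by simp
    qed
  next
    assume "p = q"
    then show "graph_dist p q = 0"
      using pq bridge_dist_self[of p] by (auto simp: graph_dist_def elim!: admissibleE)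
  qed
  show "graph_dist p r \<le> graph_dist p q + graph_dist q r"
    if "p \<in> Collect admissible" "q \<in> Collect admissible" "r \<in> Collect admissible" for p q r
    using graph_dist_triangle that by auto
qed

definition graph_metric :: "(real \<times> real) set \<Rightarrow> (real \<times> real) metric" where
  "graph_metric S = submetric (metric (Collect admissible, graph_dist)) S"

lemma graph_metric:
  assumes "S \<subseteq> Collect admissible"
  shows "mspace (graph_metric S) = S" "mdist (graph_metric S) = graph_dist"
  using assms Metric_space.mspace_metric[OF metric_space_graph_dist]
    Metric_space.mdist_metric[OF metric_space_graph_dist]
  by (auto simp: graph_metric_def)

lemma quasisymmetric_graph_metric:
  assumes "S \<subseteq> Collect admissible"
  shows "quasisymmetric (submetric euclidean_metric S) (graph_metric S) id"
proof (rule quasisymmetric_id_by_scales[where V = scale_size and b = "real b" and A = distortion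
      and p = light and q = "1 - light"])
  show "mspace (submetric euclidean_metric S) = mspace (graph_metric S)"
    using graph_metric[OF assms] by simp
  show "1 < real b" using b49 by simp
  show "0 < distortion" using distortion(2) by simp
  show "0 < light" "0 < 1 - light" "1 - light < 1" using light by auto
  have admissible: "admissible p" if "p \<in> mspace (submetric euclidean_metric S)" for p
    using that assms by auto
  show "0 < scale_size p n" "scale_size p (Suc n) \<le> (1 - light) * scale_size p n"
    "light * scale_size p n \<le> scale_size p (Suc n)"
    if "p \<in> mspace (submetric euclidean_metric S)" for p n
    using scale_size[OF admissible[OF that]] by auto
  show "\<exists>n. mdist (submetric euclidean_metric S) p q \<le> distortion / real b ^ n \<and>
      1 / real b ^ n \<le> distortion * mdist (submetric euclidean_metric S) p q \<and>
      mdist (graph_metric S) p q \<le> distortion * scale_size p n \<and>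
      scale_size p n \<le> distortion * mdist (graph_metric S) p q"
    if "p \<in> mspace (submetric euclidean_metric S)" "q \<in> mspace (submetric euclidean_metric S)" "p \<noteq> q"
    for p q
    using graph_dist_comparable[OF admissible[OF that(1)] admissible[OF that(2)] that(3)] graph_metric(2)[OF assms]
    by simp
qed

end

section \<open>Points of the Cantor set with prescribed digits\<close>

text \<open>
  In logarithms this says that \<open>k * n\<close> outgrows \<open>d * sqrt n\<close>; completing the square gives an explicit
  constant.
\<close>

lemma power_beats_exp_sqrt:
  fixes \<rho> N :: real
  assumes "0 < \<rho>" "\<rho> < N" "1 \<le> N"
  shows "\<exists>K>0. \<forall>n. \<rho> ^ n * N ^ nat \<lceil>sqrt (real n)\<rceil> \<le> K * N ^ n"
proof -
  define d where "d = ln N"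
  define k where "k = d - ln \<rho>"
  have k: "0 < k" using assms by (simp add: k_def d_def)
  have d: "0 \<le> d" using assms by (simp add: d_def)
  define K where "K = exp (d\<^sup>2 / (4 * k) + d)"
  have "\<rho> ^ n * N ^ nat \<lceil>sqrt (real n)\<rceil> \<le> K * N ^ n" for n
  proof -
    define u where "u = sqrt (real n)"
    have u: "u\<^sup>2 = real n" "0 \<le> u" by (auto simp: u_def)
    have ceil: "real (nat \<lceil>u\<rceil>) \<le> u + 1" using u by linarith
    have pow: "\<rho> ^ n = exp (real n * ln \<rho>)" "N ^ m = exp (real m * d)" for m
      using assms by (auto simp: d_def exp_of_nat_mult)
    have "0 \<le> (2 * k * u - d)\<^sup>2 / (4 * k)" using k by simp
    also have "\<dots> = k * u\<^sup>2 - d * u + d\<^sup>2 / (4 * k)"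
      using k by (simp add: field_simps power2_eq_square)
    finally have "d * u \<le> k * real n + d\<^sup>2 / (4 * k)" using u by simp
    moreover have "real (nat \<lceil>u\<rceil>) * d \<le> (u + 1) * d" using ceil d by (intro mult_right_mono) auto
    ultimately have "real n * ln \<rho> + real (nat \<lceil>u\<rceil>) * d \<le> (d\<^sup>2 / (4 * k) + d) + real n * d"
      by (simp add: k_def algebra_simps)
    then have "exp (real n * ln \<rho> + real (nat \<lceil>u\<rceil>) * d) \<le> exp ((d\<^sup>2 / (4 * k) + d) + real n * d)"
      by simp
    then show ?thesis unfolding pow K_def u_def by (simp only: exp_add)
  qed
  moreover have "0 < K" by (simp add: K_def)
  ultimately show ?thesis by blast
qed

context scale_base
begin

primrec prefix :: "(nat \<Rightarrow> nat) \<Rightarrow> nat \<Rightarrow> nat" where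
  "prefix \<omega> 0 = 0"
| "prefix \<omega> (Suc n) = b * prefix \<omega> n + \<omega> n"

text \<open>
  The point is the supremum of the left endpoints of the cells with the given first digits. Since
  no digit equals \<open>b - 1\<close>, it is not the right endpoint of any of them.
\<close>

lemma exists_cantor_digits:
  assumes "\<And>i. \<omega> i \<le> b - 2"
  shows "\<exists>x\<in>cantor. \<forall>i. cell (Suc i) x mod b = \<omega> i"
proof -
  have b: "49 \<le> real b" using b49 by simp
  define lo where "lo n = real (prefix \<omega> n) / real b ^ n" for n
  define hi where "hi n = (real (prefix \<omega> n) + 1) / real b ^ n" for n
  have lo: "lo n \<le> lo (Suc n)" for n
    using b by (simp add: lo_def field_simps)
  have hi: "hi (Suc n) < hi n" for n
  proof -
    have "real (\<omega> n) + 1 < real b" using assms[of n] b49 by linarith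
    then have "real b * real (prefix \<omega> n) + real (\<omega> n) + 1 < real b * (real (prefix \<omega> n) + 1)"
      by (simp add: algebra_simps)
    then have "(real b * real (prefix \<omega> n) + real (\<omega> n) + 1) / real b ^ Suc n <
        (real b * (real (prefix \<omega> n) + 1)) / real b ^ Suc n"
      using b by (intro divide_strict_right_mono) auto
    then show ?thesis using b by (simp add: hi_def)
  qed
  have le: "lo m \<le> hi n" for m n
  proof -
    have "lo m \<le> lo (max m n)" using incseqD[OF incseq_SucI[of lo, OF lo]] by simp
    also have "\<dots> \<le> hi (max m n)" using b by (simp add: lo_def hi_def field_simps)
    also have "\<dots> \<le> hi n" using decseqD[OF decseq_SucI[of hi, OF less_imp_le[OF hi]]] by simp
    finally show ?thesis .
  qed
  define x where "x = (SUP n. lo n)"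
  have bdd: "bdd_above (range lo)" using le by (intro bdd_aboveI2)
  have x: "lo n \<le> x" "x < hi n" for n
  proof -
    show "lo n \<le> x" unfolding x_def using bdd by (intro cSUP_upper) auto
    have "x \<le> hi (Suc n)" unfolding x_def using le by (intro cSUP_least) auto
    then show "x < hi n" using hi[of n] by linarith
  qed
  have cell: "cell n x = prefix \<omega> n" for n
    using x[of n] b by (intro cell_eqI) (auto simp: lo_def hi_def field_simps)
  have digit: "cell (Suc i) x mod b = \<omega> i" for i
    using assms[of i] b49 by (simp add: cell)
  have "cell (Suc i) x mod b \<noteq> b - 1" for i
    using digit[of i] assms[of i] b49 by simp
  moreover have "0 \<le> x" "x < 1" using x[of 0] by (auto simp: lo_def hi_def)
  ultimately have "x \<in> cantor" by (simp add: cantor_def)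
  with digit show ?thesis by blast
qed

text \<open>
  The number of values of the first \<open>n\<close> digits of a point that are available for the parameter \<open>z\<close>:
  square positions are reserved and contribute a factor 1.
\<close>

primrec radix :: "nat \<Rightarrow> nat" where
  "radix 0 = 1"
| "radix (Suc i) = (if \<exists>k. i = k ^ 2 then 1 else b - 1) * radix i"

lemma radix_pos: "0 < radix n"
  using b49 by (induction n) auto

lemma radix_times_squares: "radix n * (b - 1) ^ card {k. k ^ 2 < n} = (b - 1) ^ n"
proof (induction n)
  case (Suc n)
  have "k \<le> k ^ 2" for k :: nat by (simp add: power2_eq_square)
  then have "{k. k ^ 2 < n} \<subseteq> {..<n}" by (auto intro: order_le_less_trans)
  then have fin: "finite {k. k ^ 2 < n}" by (rule finite_subset) simp
  show ?case
  proof (cases "\<exists>k. n = k ^ 2")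
    case True
    then obtain k where k: "n = k ^ 2" by blast
    have "{j. j ^ 2 < Suc n} = insert k {j. j ^ 2 < n}"
      using k by (auto simp: less_Suc_eq)
    then show ?thesis using True Suc fin k by simp
  next
    case False
    then have "{j. j ^ 2 < Suc n} = {j. j ^ 2 < n}" by (auto simp: less_Suc_eq)
    then show ?thesis using False Suc by (simp add: mult.assoc)
  qed
qed simp

lemma radix_ge: "real (b - 1) ^ n \<le> real (radix n) * real (b - 1) ^ nat \<lceil>sqrt (real n)\<rceil>"
proof -
  define m where "m = nat \<lceil>sqrt (real n)\<rceil>"
  have "sqrt (real n) \<le> real m" unfolding m_def by (simp add: real_nat_ceiling_ge)
  then have "sqrt (real n) ^ 2 \<le> real m ^ 2" by (intro power_mono) auto
  then have "real n \<le> real (m ^ 2)" by simp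
  then have n: "n \<le> m ^ 2" by (simp only: of_nat_le_iff)
  have "{k. k ^ 2 < n} \<subseteq> {..<m}"
    using n by (auto intro!: power_less_imp_less_base[of _ 2 m])
  then have "card {k. k ^ 2 < n} \<le> m" using card_mono[of "{..<m}"] by simp
  then have "radix n * (b - 1) ^ card {k. k ^ 2 < n} \<le> radix n * (b - 1) ^ m"
    using b49 by (intro mult_left_mono power_increasing) auto
  then have "real ((b - 1) ^ n) \<le> real (radix n * (b - 1) ^ m)"
    unfolding radix_times_squares by (simp only: of_nat_le_iff)
  then show ?thesis by (simp add: m_def)
qed

lemma radix_growth:
  assumes "0 < \<rho>" "\<rho> < real (b - 1)"
  shows "\<exists>K>0. \<forall>n. \<rho> ^ n \<le> K * real (radix n)"
proof -
  have N: "1 \<le> real (b - 1)" "0 < real (b - 1)" using b49 by auto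
  obtain K where K: "0 < K" "\<And>n. \<rho> ^ n * real (b - 1) ^ nat \<lceil>sqrt (real n)\<rceil> \<le> K * real (b - 1) ^ n"
    using power_beats_exp_sqrt[OF assms N(1)] by blast
  have "\<rho> ^ n \<le> K * real (radix n)" for n
  proof -
    let ?P = "real (b - 1) ^ nat \<lceil>sqrt (real n)\<rceil>"
    have "\<rho> ^ n * ?P \<le> K * (real (radix n) * ?P)"
      using K(2)[of n] mult_left_mono[OF radix_ge[of n], of K] K(1) by linarith
    then have "\<rho> ^ n * ?P \<le> (K * real (radix n)) * ?P" by (simp only: mult.assoc)
    then show ?thesis using N(2) by (simp only: mult_le_cancel_right_pos zero_less_power)
  qed
  then show ?thesis using K(1) by blast
qed

text \<open>
  The Dedekind cut of \<open>a\<close> along an enumeration of the rationals: an injective coding of reals by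
  sequences of digits 0 and 1.
\<close>

definition rational_cut :: "real \<Rightarrow> nat \<Rightarrow> nat" where
  "rational_cut a k = (if real_of_rat (from_nat k) < a then 1 else 0)"

lemma rational_cut_inject:
  assumes "\<And>k. rational_cut a k = rational_cut a' k"
  shows "a = a'"
proof -
  have "\<not> a < a'" if eq: "\<And>k. rational_cut a k = rational_cut a' k" for a a'
  proof
    assume "a < a'"
    then obtain q where q: "a < real_of_rat q" "real_of_rat q < a'" using of_rat_dense by blast
    have "from_nat (to_nat q) = q" by simp
    then show False using eq[of "to_nat q"] q by (simp add: rational_cut_def)
  qed
  from this[of a a'] this[of a' a] show ?thesis using assms by force
qed

definition radix_cell :: "nat \<Rightarrow> real \<Rightarrow> nat" where
  "radix_cell n z = nat \<lfloor>real (radix n) * z\<rfloor>"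

text \<open>
  Away from the squares these are the digits of the mixed radix expansion of \<open>z\<close> with the partial
  products \<open>radix\<close>. At \<open>i = k ^ 2\<close> the root recovers \<open>k\<close>. No digit exceeds \<open>b - 2\<close>.
\<close>

definition point_digit :: "real \<Rightarrow> real \<Rightarrow> nat \<Rightarrow> nat" where
  "point_digit a z i =
     (if \<exists>k. i = k ^ 2 then rational_cut a (nat \<lfloor>sqrt (real i)\<rfloor>)
      else radix_cell (Suc i) z mod (b - 1))"

definition point :: "real \<Rightarrow> real \<Rightarrow> real" where
  "point a z = (SOME x. x \<in> cantor \<and> (\<forall>i. cell (Suc i) x mod b = point_digit a z i))"

lemma point: "point a z \<in> cantor" "cell (Suc i) (point a z) mod b = point_digit a z i"
proof -
  have "point_digit a z i \<le> b - 2" for i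
  proof -
    have "radix_cell (Suc i) z mod (b - 1) < b - 1" using b49 by simp
    then have "radix_cell (Suc i) z mod (b - 1) \<le> b - 2" by linarith
    moreover have "1 \<le> b - 2" using b49 by linarith
    then have "rational_cut a k \<le> b - 2" for k by (simp add: rational_cut_def)
    ultimately show ?thesis unfolding point_digit_def by (split if_split) blast
  qed
  then have "\<exists>x. x \<in> cantor \<and> (\<forall>i. cell (Suc i) x mod b = point_digit a z i)"
    using exists_cantor_digits by blast
  then have "point a z \<in> cantor \<and> (\<forall>i. cell (Suc i) (point a z) mod b = point_digit a z i)"
    unfolding point_def by (rule someI_ex)
  then show "point a z \<in> cantor" "cell (Suc i) (point a z) mod b = point_digit a z i" by auto
qed

lemma point_range: "0 \<le> point a z" "point a z < 1"
  using point(1)[of a z] by (auto simp: cantor_def)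

lemma point_digit_eq:
  assumes "cell n (point a z) = cell n (point a' z')" "i < n"
  shows "point_digit a z i = point_digit a' z' i"
  using cell_eq_mono[OF point_range(1) point_range(1) assms(1), of "Suc i"] assms(2) point(2)[of i]
  by (metis Suc_leI)

lemma point_inject:
  assumes "point a z = point a' z'"
  shows "a = a'"
proof (rule rational_cut_inject)
  fix k
  have "point_digit a z (k ^ 2) = point_digit a' z' (k ^ 2)"
    using assms by (intro point_digit_eq[of "Suc (k ^ 2)"]) auto
  moreover have "nat \<lfloor>sqrt (real (k ^ 2))\<rfloor> = k" by simp
  ultimately show "rational_cut a k = rational_cut a' k"
    unfolding point_digit_def by auto
qed

lemma radix_cell_eq:
  assumes "0 \<le> z" "z < 1" "0 \<le> z'" "z' < 1" "\<And>i. i < n \<Longrightarrow> point_digit a z i = point_digit a' z' i"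
  shows "radix_cell n z = radix_cell n z'"
  using assms(5)
proof (induction n)
  case 0
  have "\<lfloor>z\<rfloor> = 0" "\<lfloor>z'\<rfloor> = 0" using assms by (auto intro: floor_unique)
  then show ?case by (simp add: radix_cell_def)
next
  case (Suc n)
  then have IH: "radix_cell n z = radix_cell n z'" by simp
  show ?case
  proof (cases "\<exists>k. n = k ^ 2")
    case True
    then show ?thesis using IH by (simp add: radix_cell_def)
  next
    case False
    have "radix_cell (Suc n) z div (b - 1) = radix_cell n z" if "0 \<le> z" for z
      using nat_floor_mult_div[of "b - 1" "real (radix n) * z"] b49 that False
      by (simp add: radix_cell_def mult.assoc)
    then have "radix_cell (Suc n) z div (b - 1) = radix_cell (Suc n) z' div (b - 1)"
      using IH assms(1,3) by simp
    moreover have "radix_cell (Suc n) z mod (b - 1) = radix_cell (Suc n) z' mod (b - 1)"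
      using Suc.prems[of n] False by (auto simp: point_digit_def)
    ultimately show ?thesis by (metis mult_div_mod_eq)
  qed
qed

lemma radix_cell_close:
  assumes "0 \<le> z" "0 \<le> z'" "radix_cell n z = radix_cell n z'"
  shows "\<bar>z - z'\<bar> \<le> 1 / real (radix n)"
proof -
  have "\<lfloor>real (radix n) * z\<rfloor> = \<lfloor>real (radix n) * z'\<rfloor>"
    using assms by (simp add: radix_cell_def eq_nat_nat_iff)
  then have "\<bar>real (radix n) * z - real (radix n) * z'\<bar> \<le> 1" by linarith
  then have "real (radix n) * \<bar>z - z'\<bar> \<le> 1"
    by (simp add: abs_mult right_diff_distrib[symmetric])
  then show ?thesis using radix_pos[of n] by (simp add: field_simps)
qed

text \<open>
  Two points at distance about \<open>1 / b ^ m\<close> share the digits up to level \<open>m - 2\<close>, hence their parameters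
  share the cell of length \<open>1 / radix (m - 2)\<close>; up to a subexponential factor this is
  \<open>1 / (b - 1) ^ m\<close>. Different values of \<open>a\<close> are allowed, which is what the graph needs.
\<close>

lemma parameter_hoelder:
  assumes "0 < t" "real b powr t < real (b - 1)"
  shows "\<exists>K>0. \<forall>a a' z z'. 0 \<le> z \<longrightarrow> z < 1 \<longrightarrow> 0 \<le> z' \<longrightarrow> z' < 1 \<longrightarrow>
    \<bar>z - z'\<bar> \<le> K * \<bar>point a z - point a' z'\<bar> powr t"
proof -
  have b: "49 \<le> real b" using b49 by simp
  define \<rho> where "\<rho> = real b powr t"
  have \<rho>: "1 < \<rho>" using assms b by (simp add: \<rho>_def)
  have "0 < \<rho>" "\<rho> < real (b - 1)" using \<rho> assms(2) by (simp_all only: \<rho>_def)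
  then obtain K where K: "0 < K" "\<And>n. \<rho> ^ n \<le> K * real (radix n)"
    using radix_growth by blast
  have close: "\<bar>z - z'\<bar> \<le> K / \<rho> ^ n"
    if "0 \<le> z" "z < 1" "0 \<le> z'" "z' < 1" "cell n (point a z) = cell n (point a' z')" for a a' z z' n
  proof -
    have "radix_cell n z = radix_cell n z'"
      by (rule radix_cell_eq[OF that(1-4) point_digit_eq[OF that(5)]])
    then have "\<bar>z - z'\<bar> \<le> 1 / real (radix n)"
      by (rule radix_cell_close[OF that(1,3)])
    also have "\<dots> \<le> K / \<rho> ^ n"
      using K(2)[of n] radix_pos[of n] \<rho> by (simp add: field_simps)
    finally show ?thesis .
  qed
  have "\<bar>z - z'\<bar> \<le> (K * \<rho> ^ 3) * \<bar>point a z - point a' z'\<bar> powr t"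
    if z: "0 \<le> z" "z < 1" "0 \<le> z'" "z' < 1" for a a' z z'
  proof (cases "point a z = point a' z'")
    case True
    \<comment> \<open>Equal points agree at all levels, so their parameters coincide.\<close>
    have "(\<lambda>n. K / \<rho> ^ n) \<longlonglongrightarrow> 0"
      using \<rho> by (intro LIMSEQ_divide_realpow_zero) auto
    moreover have "\<bar>z - z'\<bar> \<le> K / \<rho> ^ n" for n
      using True by (intro close[OF z, of n a a']) simp
    ultimately have "\<bar>z - z'\<bar> \<le> 0"
      by (intro LIMSEQ_le_const) blast+
    then show ?thesis using True by simp
  next
    case False
    define \<delta> where "\<delta> = \<bar>point a z - point a' z'\<bar>"
    have "0 < \<delta>" "\<delta> \<le> 1" using False point_range[of a z] point_range[of a' z'] by (auto simp: \<delta>_def)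
    then obtain m where m: "1 / real b ^ Suc m < \<delta>" "\<delta> \<le> 1 / real b ^ m"
      using exists_scale[of "real b" \<delta>] b by auto
    have "\<bar>z - z'\<bar> \<le> K / \<rho> ^ (m - 2)"
      using m(2) z by (intro close[OF z] cantor_same_cell point) (simp add: \<delta>_def)
    also have "\<dots> \<le> K * \<rho> ^ 3 * (1 / \<rho> ^ Suc m)"
    proof -
      have "\<rho> ^ Suc m \<le> \<rho> ^ (3 + (m - 2))" using \<rho> by (intro power_increasing) auto
      then have "\<rho> ^ Suc m \<le> \<rho> ^ 3 * \<rho> ^ (m - 2)" by (simp only: power_add)
      then have "1 / \<rho> ^ (m - 2) \<le> \<rho> ^ 3 / \<rho> ^ Suc m" using \<rho> by (simp add: field_simps)
      then have "K * (1 / \<rho> ^ (m - 2)) \<le> K * (\<rho> ^ 3 / \<rho> ^ Suc m)" using K(1) by (intro mult_left_mono) auto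
      then show ?thesis by simp
    qed
    also have "1 / \<rho> ^ Suc m = (1 / real b ^ Suc m) powr t"
    proof -
      have "(real b ^ j) powr t = \<rho> ^ j" for j
        using b by (simp add: \<rho>_def powr_powr mult.commute flip: powr_realpow)
      then show ?thesis by (simp only: powr_divide powr_one_eq_one)
    qed
    also have "K * \<rho> ^ 3 * (1 / real b ^ Suc m) powr t \<le> K * \<rho> ^ 3 * \<delta> powr t"
      using m(1) assms(1) K(1) \<rho> b by (intro mult_left_mono powr_mono2) auto
    finally show ?thesis by (simp add: \<delta>_def)
  qed
  moreover have "0 < K * \<rho> ^ 3" using K(1) \<rho> by simp
  ultimately show ?thesis by blast
qed

end

section \<open>The function, its graph and the dimensions\<close>

context scale_base
begin

text \<open>
  By \<open>point_inject\<close> the choice of the value is unique.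
\<close>

definition graph_fun :: "real \<Rightarrow> real" where
  "graph_fun x = (if \<exists>a\<in>light_heights. \<exists>z. 0 \<le> z \<and> z < 1 \<and> x = point a z
     then SOME a. a \<in> light_heights \<and> (\<exists>z. 0 \<le> z \<and> z < 1 \<and> x = point a z) else 0)"

lemma graph_fun_cases:
  obtains "graph_fun x = 0" "\<And>a z. a \<in> light_heights \<Longrightarrow> 0 \<le> z \<Longrightarrow> z < 1 \<Longrightarrow> x \<noteq> point a z"
  | z where "graph_fun x \<in> light_heights" "0 \<le> z" "z < 1" "x = point (graph_fun x) z"
proof (cases "\<exists>a\<in>light_heights. \<exists>z. 0 \<le> z \<and> z < 1 \<and> x = point a z")
  case True
  then have "\<exists>a. a \<in> light_heights \<and> (\<exists>z. 0 \<le> z \<and> z < 1 \<and> x = point a z)" by blast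
  from someI_ex[OF this] show ?thesis using True that(2) by (auto simp: graph_fun_def)
next
  case False
  then have "graph_fun x = 0" unfolding graph_fun_def by (rule if_not_P)
  with False that(1) show ?thesis by blast
qed

lemma graph_fun_point:
  assumes "a \<in> light_heights" "0 \<le> z" "z < 1"
  shows "graph_fun (point a z) = a"
proof (cases "point a z" rule: graph_fun_cases)
  case 1
  then show ?thesis using assms by blast
next
  case (2 z')
  then show ?thesis using point_inject by metis
qed

definition the_graph :: "(real \<times> real) set" where
  "the_graph = graph_of graph_fun"

lemma point_in_the_graph:
  assumes "a \<in> light_heights" "0 \<le> z" "z < 1"
  shows "(point a z, a) \<in> the_graph"
  using graph_fun_point[OF assms] point_range[of a z]
  by (auto simp: the_graph_def graph_of_def intro!: exI[of _ "point a z"])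

lemma the_graph_admissible: "the_graph \<subseteq> Collect admissible"
proof
  fix p assume "p \<in> the_graph"
  then obtain x where x: "p = (x, graph_fun x)" "0 \<le> x" "x \<le> 1"
    by (auto simp: the_graph_def graph_of_def)
  show "p \<in> Collect admissible"
  proof (cases x rule: graph_fun_cases)
    case 1
    then show ?thesis using x by (simp add: admissible_def)
  next
    case (2 z)
    then have "x \<in> cantor" using point(1)[of "graph_fun x" z] by simp
    then show ?thesis using x 2(1) by (simp add: admissible_def)
  qed
qed

lemma graph_fun_range: "graph_fun \<in> {0..1} \<rightarrow> {0..1}"
proof
  fix x :: real
  show "graph_fun x \<in> {0..1}"
    by (cases x rule: graph_fun_cases) (use light_heights_range[of "graph_fun x"] in auto)
qed

lemma the_graph_slice:
  assumes "a \<in> light_heights"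
  shows "the_graph \<inter> (UNIV \<times> {a}) = (\<lambda>z. (point a z, a)) ` {0..<1}"
proof (intro subset_antisym subsetI)
  fix p assume "p \<in> the_graph \<inter> (UNIV \<times> {a})"
  then obtain x where x: "p = (x, a)" "graph_fun x = a"
    by (auto simp: the_graph_def graph_of_def)
  show "p \<in> (\<lambda>z. (point a z, a)) ` {0..<1}"
    by (cases x rule: graph_fun_cases) (use x light_heights_range[OF assms] in auto)
qed (use point_in_the_graph[OF assms] in auto)

definition slice_dim :: real where "slice_dim = log (real b) (real (b - 1))"

lemma slice_dim: "0 < slice_dim" "real b powr slice_dim = real (b - 1)" "real b powr t < real (b - 1) \<longleftrightarrow> t < slice_dim"
proof -
  have b: "1 < real b" "1 < real (b - 1)" using b49 by auto
  show "0 < slice_dim" using b unfolding slice_dim_def by simp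
  show e: "real b powr slice_dim = real (b - 1)" using b unfolding slice_dim_def by (intro powr_log_cancel) auto
  show "real b powr t < real (b - 1) \<longleftrightarrow> t < slice_dim"
    unfolding e[symmetric] using b by simp
qed

lemma cell_unit_interval: "0 \<le> x \<Longrightarrow> x \<le> 1 \<Longrightarrow> cell n x \<le> b ^ n"
proof -
  assume x: "0 \<le> x" "x \<le> 1"
  then have "real b ^ n * x \<le> real b ^ n * 1" by (intro mult_left_mono) auto
  then have "real (cell n x) \<le> real b ^ n" using cell_bounds(1)[OF x(1), of n] by linarith
  then show ?thesis by (metis of_nat_le_iff of_nat_power)
qed

text \<open>
  The cells of the Cantor set give the upper bound. For the lower bound, the slice is parametrized
  by \<open>z\<close>, and a ball of radius \<open>r\<close> only meets parameters in an interval of length \<open>2 * K * r powr t\<close>.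
\<close>

lemma hausdorff_dim_slice:
  assumes a: "a \<in> light_heights"
  shows "hausdorff_dim euclidean_metric (the_graph \<inter> (UNIV \<times> {a})) = ereal slice_dim"
proof (rule hausdorff_dim_eqI)
  show "0 \<le> slice_dim" using slice_dim(1) by simp
next
  fix t assume t: "slice_dim < t"
  have b: "49 \<le> real b" using b49 by simp
  let ?E = "the_graph \<inter> (UNIV \<times> {a})"
  have E: "fst p \<in> cantor \<and> snd p = a" if "p \<in> ?E" for p
    using that point(1) unfolding the_graph_slice[OF a] by auto
  show "hausdorff_measure euclidean_metric t ?E = 0"
  proof (rule hausdorff_measure_eq_0_by_geometric_codes[where code = "\<lambda>n p. cell n (fst p)"
        and A = 1 and B = "real (b - 1)" and C = 1 and D = "real b"])
    show "0 < t" using t slice_dim(1) by simp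
    show "1 < real b" using b by simp
    have "real b powr slice_dim < real b powr t" using t b by (intro powr_less_mono) auto
    then show "real (b - 1) < real b powr t" by (simp only: slice_dim(2))
    have sub: "(\<lambda>p. cell n (fst p)) ` ?E \<subseteq> cell n ` cantor" for n using E by auto
    show "finite ((\<lambda>p. cell n (fst p)) ` ?E)" for n
      using sub card_cantor_cells finite_subset by blast
    have "card ((\<lambda>p. cell n (fst p)) ` ?E) \<le> (b - 1) ^ n" for n
      using card_mono[OF _ sub] card_cantor_cells order_trans by blast
    then show "real (card ((\<lambda>p. cell n (fst p)) ` ?E)) \<le> 1 * real (b - 1) ^ n" for n
      by (metis mult_1 of_nat_le_iff of_nat_power)
    show "mdist euclidean_metric p q \<le> 1 / real b ^ n"
      if "p \<in> ?E" "q \<in> ?E" "cell n (fst p) = cell n (fst q)" for n p q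
    proof -
      have "dist p q = \<bar>fst p - fst q\<bar>" using E[OF that(1)] E[OF that(2)]
        by (simp add: dist_prod_def dist_real_def)
      then show ?thesis
        using cell_eq_imp_close[of "fst p" "fst q" n] that(3) E[OF that(1)] E[OF that(2)]
        by (simp add: cantor_def)
    qed
  qed auto
next
  fix u :: real assume u: "0 \<le> u" "u < slice_dim"
  define t where "t = (u + slice_dim) / 2"
  have t: "0 < t" "u \<le> t" "t < slice_dim" using u slice_dim(1) by (auto simp: t_def)
  obtain K where K: "0 < K" "\<And>a a' z z'. 0 \<le> z \<Longrightarrow> z < 1 \<Longrightarrow> 0 \<le> z' \<Longrightarrow> z' < 1 \<Longrightarrow>
      \<bar>z - z'\<bar> \<le> K * \<bar>point a z - point a' z'\<bar> powr t"
    using parameter_hoelder[OF t(1)] t(3) slice_dim(3) by blast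
  show "hausdorff_measure euclidean_metric u (the_graph \<inter> (UNIV \<times> {a})) \<noteq> 0"
  proof (rule hausdorff_measure_neq_0_by_parametrization[where M = lborel and S = "{0..<1::real}"
        and \<psi> = "\<lambda>z. (point a z, a)" and t = t and K = "2 * K"])
    show "(\<lambda>z. (point a z, a)) ` {0..<1} \<subseteq> the_graph \<inter> (UNIV \<times> {a})"
      using the_graph_slice[OF a] by simp
    fix z0 r :: real assume z0: "z0 \<in> {0..<1}" and r: "0 \<le> r"
    let ?R = "{z0 - K * r powr t..z0 + K * r powr t}"
    have "{z \<in> {0..<1}. mdist euclidean_metric (point a z0, a) (point a z, a) \<le> r} \<subseteq> ?R"
    proof safe
      fix z assume z: "z \<in> {0..<1::real}" "mdist euclidean_metric (point a z0, a) (point a z, a) \<le> r"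
      have "K * \<bar>point a z0 - point a z\<bar> powr t \<le> K * r powr t"
        using z(2) t(1) K(1) by (intro mult_left_mono powr_mono2) (auto simp: dist_prod_def dist_real_def)
      then show "z \<in> ?R" using K(2)[of z0 z a a] z0 z(1) by auto
    qed
    moreover have "emeasure lborel ?R = ennreal (2 * K * r powr t)"
      using K(1) by (simp add: field_simps)
    ultimately show "\<exists>R\<in>sets lborel. {z \<in> {0..<1}. mdist euclidean_metric (point a z0, a) (point a z, a) \<le> r} \<subseteq> R \<and>
        emeasure lborel R \<le> ennreal (2 * K * r powr t)"
      by (intro bexI[of _ ?R]) auto
  qed (use u t K in auto)
qed

text \<open>
  The upper bound counts squares of side \<open>1 / b ^ n\<close>. For the lower bound, a ball of radius \<open>r\<close> only
  meets parameters \<open>(a, z)\<close> in a rectangle with sides \<open>2 * r\<close> and \<open>2 * K * r powr t\<close>: this is where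
  positive Lebesgue measure of the set of heights is needed.
\<close>

lemma hausdorff_dim_the_graph: "hausdorff_dim euclidean_metric the_graph = ereal (1 + slice_dim)"
proof (rule hausdorff_dim_eqI)
  show "0 \<le> 1 + slice_dim" using slice_dim(1) by simp
next
  fix t assume t: "1 + slice_dim < t"
  have b: "49 \<le> real b" using b49 by simp
  have pow: "real (b - 1) * real b < real b powr t"
  proof -
    have "real b powr (slice_dim + 1) < real b powr t" using t b by (intro powr_less_mono) auto
    then show ?thesis using slice_dim(2) b by (simp add: powr_add)
  qed
  let ?code = "\<lambda>n p. (cell n (fst p), cell n (snd p))"
  show "hausdorff_measure euclidean_metric t the_graph = 0"
  proof (rule hausdorff_measure_eq_0_by_geometric_codes[where code = ?code
        and A = 2 and B = "real (b - 1) * real b" and C = 3 and D = "real b"])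
    show "0 < t" using t slice_dim(1) by simp
    show "1 < real b" using b by simp
    show "real (b - 1) * real b < real b powr t" by (rule pow)
    have sub: "?code n ` the_graph \<subseteq> cell n ` cantor \<times> {..<b ^ n} \<union> {..b ^ n} \<times> {0}" for n
    proof (rule image_subsetI)
      fix p assume "p \<in> the_graph"
      then have "admissible p" using the_graph_admissible by auto
      then show "?code n p \<in> cell n ` cantor \<times> {..<b ^ n} \<union> {..b ^ n} \<times> {0}"
        by (cases rule: admissibleE)
          (use cell_unit_interval[of "fst p" n] cell_less_power[of "snd p" n] in \<open>auto simp: cell_def[of n 0]\<close>)
    qed
    show "finite (?code n ` the_graph)" for n
      using finite_subset[OF sub] card_cantor_cells by blast
    show "real (card (?code n ` the_graph)) \<le> 3 * (real (b - 1) * real b) ^ n" for n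
    proof -
      have fin: "finite (cell n ` cantor)" "card (cell n ` cantor) \<le> (b - 1) ^ n" using card_cantor_cells by auto
      have "card (?code n ` the_graph) \<le> card (cell n ` cantor \<times> {..<b ^ n} \<union> {..b ^ n} \<times> {0::nat})"
        using fin by (intro card_mono sub) auto
      also have "\<dots> \<le> card (cell n ` cantor \<times> {..<b ^ n}) + card ({..b ^ n} \<times> {0::nat})"
        by (rule card_Un_le)
      also have "\<dots> \<le> (b - 1) ^ n * b ^ n + (b ^ n + 1)"
        using fin(2) by (simp add: card_cartesian_product)
      also have "\<dots> \<le> 3 * ((b - 1) ^ n * b ^ n)"
      proof -
        have "1 \<le> (b - 1) ^ n" using b49 by (intro one_le_power) simp
        then have "1 * b ^ n \<le> (b - 1) ^ n * b ^ n" by (intro mult_right_mono) auto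
        moreover have "1 \<le> b ^ n" using b49 by (intro one_le_power) simp
        ultimately show ?thesis by linarith
      qed
      finally have "real (card (?code n ` the_graph)) \<le> real (3 * ((b - 1) ^ n * b ^ n))" by (simp only: of_nat_le_iff)
      then show ?thesis by (simp only: of_nat_mult of_nat_power of_nat_numeral power_mult_distrib)
    qed
    show "mdist euclidean_metric p q \<le> 2 / real b ^ n"
      if "p \<in> the_graph" "q \<in> the_graph" "?code n p = ?code n q" for n p q
    proof -
      have "0 \<le> fst p" "0 \<le> snd p" "0 \<le> fst q" "0 \<le> snd q"
        using that(1,2) the_graph_admissible by (auto elim!: admissibleE)
      then have "\<bar>fst p - fst q\<bar> < 1 / real b ^ n" "\<bar>snd p - snd q\<bar> < 1 / real b ^ n"
        using that(3) by (auto intro: cell_eq_imp_close)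
      moreover have "dist p q \<le> \<bar>fst p - fst q\<bar> + \<bar>snd p - snd q\<bar>"
        using sqrt_sum_squares_le_sum_abs[of "fst p - fst q" "snd p - snd q"]
        by (simp add: dist_prod_def dist_real_def)
      ultimately show ?thesis by simp
    qed
  qed auto
next
  fix u :: real assume u: "0 \<le> u" "u < 1 + slice_dim"
  \<comment> \<open>An exponent strictly between 0 and \<open>slice_dim\<close> with \<open>u \<le> 1 + t\<close>.\<close>
  define t where "t = max (slice_dim / 2) ((u - 1 + slice_dim) / 2)"
  have t: "0 < t" "u \<le> 1 + t" "t < slice_dim" using u slice_dim(1) by (auto simp: t_def max_def field_simps)
  obtain K where K: "0 < K" "\<And>a a' z z'. 0 \<le> z \<Longrightarrow> z < 1 \<Longrightarrow> 0 \<le> z' \<Longrightarrow> z' < 1 \<Longrightarrow>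
      \<bar>z - z'\<bar> \<le> K * \<bar>point a z - point a' z'\<bar> powr t"
    using parameter_hoelder[OF t(1)] t(3) slice_dim(3) by blast
  show "hausdorff_measure euclidean_metric u the_graph \<noteq> 0"
  proof (rule hausdorff_measure_neq_0_by_parametrization[where M = "lborel \<Otimes>\<^sub>M lborel"
        and S = "light_heights \<times> {0..<1::real}"
        and \<psi> = "\<lambda>(a, z). (point a z, a)" and t = "1 + t" and K = "4 * K"])
    show "light_heights \<times> {0..<1::real} \<in> sets (lborel \<Otimes>\<^sub>M lborel)"
      using light_heights_borel by (intro pair_measureI) auto
    show "0 < emeasure (lborel \<Otimes>\<^sub>M lborel) (light_heights \<times> {0..<1::real})"
      using light_heights_borel emeasure_light_heights
      by (subst lborel.emeasure_pair_measure_Times) auto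
    show "(\<lambda>(a, z). (point a z, a)) ` (light_heights \<times> {0..<1}) \<subseteq> the_graph"
      using point_in_the_graph by auto
    fix s0 :: "real \<times> real" and r :: real assume s0: "s0 \<in> light_heights \<times> {0..<1}" and r: "0 \<le> r"
    obtain a0 z0 where az: "s0 = (a0, z0)" by fastforce
    let ?R = "{a0 - r..a0 + r} \<times> {z0 - K * r powr t..z0 + K * r powr t}"
    let ?\<psi> = "\<lambda>(a, z). (point a z, a)"
    have sub: "{s \<in> light_heights \<times> {0..<1}. mdist euclidean_metric (?\<psi> s0) (?\<psi> s) \<le> r} \<subseteq> ?R"
    proof
      fix s assume s: "s \<in> {s \<in> light_heights \<times> {0..<1}. mdist euclidean_metric (?\<psi> s0) (?\<psi> s) \<le> r}"
      obtain a z where s': "s = (a, z)" by fastforce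
      have d: "dist (point a0 z0, a0) (point a z, a) \<le> r" using s az s' by simp
      have d1: "\<bar>point a0 z0 - point a z\<bar> \<le> r" "\<bar>a0 - a\<bar> \<le> r"
        using order_trans[OF dist_fst_le d] order_trans[OF dist_snd_le d] by (auto simp: dist_real_def)
      have "K * \<bar>point a0 z0 - point a z\<bar> powr t \<le> K * r powr t"
        using d1 t(1) K(1) by (intro mult_left_mono powr_mono2) auto
      moreover have "\<bar>z0 - z\<bar> \<le> K * \<bar>point a0 z0 - point a z\<bar> powr t"
        using s s0 az s' by (intro K(2)) auto
      ultimately show "s \<in> ?R" using d1 s' by auto
    qed
    have "emeasure (lborel \<Otimes>\<^sub>M lborel) ?R = ennreal (2 * r) * ennreal (2 * (K * r powr t))"
      using r K(1) by (subst lborel.emeasure_pair_measure_Times) auto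
    also have "\<dots> = ennreal (4 * K * r powr (1 + t))"
      using r K(1) by (subst ennreal_mult[symmetric]) (auto simp: powr_add)
    finally show "\<exists>R\<in>sets (lborel \<Otimes>\<^sub>M lborel).
        {s \<in> light_heights \<times> {0..<1}. mdist euclidean_metric (?\<psi> s0) (?\<psi> s) \<le> r} \<subseteq> R \<and>
        emeasure (lborel \<Otimes>\<^sub>M lborel) R \<le> ennreal (4 * K * r powr (1 + t))"
      using sub by (intro bexI[of _ ?R] conjI pair_measureI) auto
  qed (use u t K in auto)
qed

text \<open>
  Over the Cantor set, the pieces of level \<open>n\<close> have diameter at most twice the mass of a cell that
  is not heavy, that is \<open>2 / b ^ (2 * n)\<close>, and there are at most \<open>b ^ (2 * n)\<close> of them. The
  horizontal piece is cut at level \<open>2 * n\<close> to match this diameter. It contains the segment of the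
  numbers with first digit \<open>b - 1\<close>, which makes the dimension at least 1.
\<close>

lemma hausdorff_dim_graph_metric: "hausdorff_dim (graph_metric the_graph) the_graph = 1"
proof -
  have b: "49 \<le> real b" using b49 by simp
  note new = graph_metric[OF the_graph_admissible]
  have "hausdorff_dim (graph_metric the_graph) the_graph = ereal 1"
  proof (rule hausdorff_dim_eqI)
    fix t :: real assume t: "1 < t"
    let ?code = "\<lambda>n p. if snd p = 0 then (0::nat, cell (2 * n) (fst p), 0)
      else (1, cell n (fst p), cell n (snd p))"
    show "hausdorff_measure (graph_metric the_graph) t the_graph = 0"
    proof (rule hausdorff_measure_eq_0_by_geometric_codes[where code = ?code
          and A = 2 and B = "real b ^ 2" and C = 3 and D = "real b ^ 2"])
      show "0 < t" using t by simp
      show D: "1 < real b ^ 2" using b by (intro one_less_power) auto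
      have "(real b ^ 2) powr 1 < (real b ^ 2) powr t" using t D by (intro powr_less_mono) auto
      then show "real b ^ 2 < (real b ^ 2) powr t" by simp
      show "the_graph \<subseteq> mspace (graph_metric the_graph)" using new by simp
      let ?U = "\<lambda>n. {0::nat} \<times> {..b ^ (2 * n)} \<times> {0} \<union> {1} \<times> cell n ` cantor \<times> {..<b ^ n}"
      have sub: "?code n ` the_graph \<subseteq> ?U n" for n
      proof (rule image_subsetI)
        fix p assume "p \<in> the_graph"
        then have "admissible p" using the_graph_admissible by auto
        then show "?code n p \<in> ?U n"
          by (cases rule: admissibleE) (use cell_unit_interval[of "fst p" "2 * n"] cell_less_power[of "snd p" n] in auto)
      qed
      show "finite (?code n ` the_graph)" for n
        using finite_subset[OF sub] card_cantor_cells by blast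
      show "real (card (?code n ` the_graph)) \<le> 3 * (real b ^ 2) ^ n" for n
      proof -
        have fin: "finite (cell n ` cantor)" "card (cell n ` cantor) \<le> (b - 1) ^ n" using card_cantor_cells by auto
        have "card (?code n ` the_graph) \<le> card (?U n)"
          using fin by (intro card_mono sub) auto
        also have "\<dots> \<le> card ({0::nat} \<times> {..b ^ (2 * n)} \<times> {0::nat}) + card ({1::nat} \<times> cell n ` cantor \<times> {..<b ^ n})"
          by (rule card_Un_le)
        also have "\<dots> \<le> (b ^ (2 * n) + 1) + (b - 1) ^ n * b ^ n"
          using fin(2) by (simp add: card_cartesian_product)
        also have "\<dots> \<le> 3 * b ^ (2 * n)"
        proof -
          have "(b - 1) ^ n * b ^ n \<le> b ^ n * b ^ n" by (intro mult_right_mono power_mono) auto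
          also have "\<dots> = b ^ (2 * n)" by (simp add: power_add[symmetric] mult_2)
          finally have "(b - 1) ^ n * b ^ n \<le> b ^ (2 * n)" .
          moreover have "1 \<le> b ^ (2 * n)" using b49 by (intro one_le_power) simp
          ultimately show ?thesis by linarith
        qed
        finally have "real (card (?code n ` the_graph)) \<le> real (3 * b ^ (2 * n))" by (simp only: of_nat_le_iff)
        then show ?thesis by (simp only: of_nat_mult of_nat_power of_nat_numeral power_mult)
      qed
      show "mdist (graph_metric the_graph) p q \<le> 2 / (real b ^ 2) ^ n"
        if "p \<in> the_graph" "q \<in> the_graph" and code: "?code n p = ?code n q" for n p q
      proof -
        have pq: "admissible p" "admissible q" using that(1,2) the_graph_admissible by auto
        have iff: "snd p = 0 \<longleftrightarrow> snd q = 0" using code by (auto split: if_splits)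
        have "graph_dist p q \<le> 2 / real b ^ (2 * n)"
        proof (cases "snd p = 0")
          case True
          then have "\<bar>fst p - fst q\<bar> < 1 / real b ^ (2 * n)"
            using pq iff code by (intro cell_eq_imp_close) (auto elim!: admissibleE)
          moreover have "1 / real b ^ (2 * n) \<le> 2 / real b ^ (2 * n)"
            by (intro divide_right_mono) auto
          ultimately show ?thesis using True iff by (simp add: graph_dist_def)
        next
          case False
          have y: "0 \<le> snd p" "0 \<le> snd q" "snd p \<in> light_heights"
            using pq False iff by (auto elim!: admissibleE)
          have c: "cell n (fst p) = cell n (fst q)" "cell n (snd p) = cell n (snd q)"
            using code False iff by auto
          have "bridge_dist p q \<le> \<bar>height (snd p) - height (snd q)\<bar> + cell_weight n (snd p)"
            using bridge_dist_le[OF bridge_costsI[OF y(1), of n p q]] c by simp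
          also have "\<dots> \<le> 2 * cell_weight n (snd p)"
            using height_diff_same_cell[OF y(1,2) c(2)] by simp
          also have "\<dots> \<le> 2 * (1 / real b ^ (2 * n))"
            using cell_weight_light_heights[OF y(3), of n] by simp
          finally show ?thesis using False iff by (simp add: graph_dist_def)
        qed
        then show ?thesis using new by (simp add: power_mult)
      qed
    qed auto
  next
    fix u :: real assume u: "0 \<le> u" "u < 1"
    let ?S = "{1 - 1 / real b..<1}"
    have S: "(x, 0) \<in> the_graph" if "x \<in> ?S" for x
    proof -
      have "1 / real b \<le> 1" using b by simp
      then have x: "0 \<le> x" "x < 1" "1 - 1 / real b \<le> x" using that by auto
      have "real (b - 1) \<le> real b ^ 1 * x" "real b ^ 1 * x < real (b - 1) + 1"
        using x b49 by (auto simp: of_nat_diff field_simps)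
      then have "cell (Suc 0) x = b - 1" by (intro cell_eqI) auto
      then have "cell (Suc 0) x mod b = b - 1" using b49 by simp
      then have "x \<notin> cantor" unfolding cantor_def by blast
      then have "graph_fun x = 0"
        by (cases x rule: graph_fun_cases) (use point(1) in metis)+
      then show ?thesis using x by (auto simp: the_graph_def graph_of_def intro!: exI[of _ x])
    qed
    show "hausdorff_measure (graph_metric the_graph) u the_graph \<noteq> 0"
    proof (rule hausdorff_measure_neq_0_by_parametrization[where M = lborel and S = ?S
          and \<psi> = "\<lambda>x. (x, 0)" and t = 1 and K = 2])
      show "0 < emeasure lborel ?S" using b by simp
      show "(\<lambda>x. (x, 0)) ` ?S \<subseteq> the_graph" using S by auto
      fix x0 r :: real assume r: "0 \<le> r"
      show "\<exists>R\<in>sets lborel. {x \<in> ?S. mdist (graph_metric the_graph) (x0, 0) (x, 0) \<le> r} \<subseteq> R \<and>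
          emeasure lborel R \<le> ennreal (2 * r powr 1)"
        using r by (intro bexI[of _ "{x0 - r..x0 + r}"]) (auto simp: new graph_dist_def)
    qed (use u in auto)
  qed simp
  then show ?thesis by (simp add: one_ereal_def)
qed

end

text \<open>
  Any base with \<open>2 \<le> b powr (1 - \<beta>)\<close> will do, as then \<open>b powr \<beta> \<le> b / 2\<close>.
\<close>

lemma exists_scale_base:
  fixes \<beta> :: real
  assumes "0 < \<beta>" "\<beta> < 1"
  shows "\<exists>c::nat. 7 \<le> c \<and> real (c ^ 2) powr \<beta> < real (c ^ 2 - 1)"
proof -
  obtain c0 :: nat where c0: "2 powr (1 / (1 - \<beta>)) \<le> real c0" using real_arch_simple by blast
  define c where "c = max 7 c0"
  define b where "b = real (c ^ 2)"
  have c: "7 \<le> c" "2 powr (1 / (1 - \<beta>)) \<le> real c" using c0 by (auto simp: c_def max_def)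
  have "real c * 1 \<le> real c * real c" using c(1) by (intro mult_left_mono) auto
  then have cb: "real c \<le> b" by (simp add: b_def power2_eq_square)
  have "2 = (2 powr (1 / (1 - \<beta>))) powr (1 - \<beta>)" using assms by (simp add: powr_powr)
  also have "\<dots> \<le> b powr (1 - \<beta>)" using c(2) cb assms by (intro powr_mono2) auto
  finally have "2 * b powr \<beta> \<le> b powr (1 - \<beta>) * b powr \<beta>" by (intro mult_right_mono) auto
  also have "\<dots> = b" using cb c(1) by (simp add: powr_add[symmetric])
  finally have "b powr \<beta> \<le> b / 2" by simp
  also have "\<dots> < b - 1" using cb c(1) by simp
  also have "b - 1 = real (c ^ 2 - 1)" using c(1) by (simp add: b_def of_nat_diff Suc_leI)
  finally show ?thesis using c(1) by (auto simp: b_def)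
qed

theorem theorem1p1:
  fixes \<alpha> :: real
  assumes "1 < \<alpha>" and "\<alpha> < 2"
  shows "\<exists>f :: real \<Rightarrow> real.
    f \<in> {0..1} \<rightarrow> {0..1} \<and>
    hausdorff_dim euclidean_metric (graph_of f) > ereal \<alpha> \<and>
    (\<exists>(Y :: (real \<times> real) metric) g.
       quasisymmetric (submetric euclidean_metric (graph_of f)) Y g \<and>
       hausdorff_dim Y (mspace Y) = 1) \<and>
    (\<exists>A. A \<subseteq> {0..1} \<and> A \<in> sets lebesgue \<and> emeasure lebesgue A > 0 \<and>
       (\<forall>a\<in>A. hausdorff_dim euclidean_metric (graph_of f \<inter> (UNIV \<times> {a})) =
              hausdorff_dim euclidean_metric (graph_of f) - 1))"
proof -
  obtain c :: nat where c: "7 \<le> c" "real (c ^ 2) powr (\<alpha> - 1) < real (c ^ 2 - 1)"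
    using exists_scale_base[of "\<alpha> - 1"] assms by auto
  interpret scale_base "c ^ 2" c
    using c(1) by unfold_locales auto
  have \<alpha>: "\<alpha> - 1 < slice_dim" using c(2) slice_dim(3) by blast
  show ?thesis
  proof (intro exI[of _ graph_fun] conjI)
    show "graph_fun \<in> {0..1} \<rightarrow> {0..1}" by (rule graph_fun_range)
    show "ereal \<alpha> < hausdorff_dim euclidean_metric (graph_of graph_fun)"
      using hausdorff_dim_the_graph \<alpha> by (simp add: the_graph_def)
    show "\<exists>(Y :: (real \<times> real) metric) g.
       quasisymmetric (submetric euclidean_metric (graph_of graph_fun)) Y g \<and>
       hausdorff_dim Y (mspace Y) = 1"
      using quasisymmetric_graph_metric[OF the_graph_admissible] hausdorff_dim_graph_metric
        graph_metric(1)[OF the_graph_admissible]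
      by (intro exI[of _ "graph_metric the_graph"] exI[of _ id]) (simp add: the_graph_def)
    show "\<exists>A. A \<subseteq> {0..1} \<and> A \<in> sets lebesgue \<and> emeasure lebesgue A > 0 \<and>
       (\<forall>a\<in>A. hausdorff_dim euclidean_metric (graph_of graph_fun \<inter> (UNIV \<times> {a})) =
              hausdorff_dim euclidean_metric (graph_of graph_fun) - 1)"
    proof (intro exI[of _ light_heights] conjI ballI)
      show "light_heights \<subseteq> {0..1}" using light_heights_range by force
      show "light_heights \<in> sets lebesgue" using light_heights_borel by auto
      show "0 < emeasure lebesgue light_heights"
        using emeasure_light_heights light_heights_borel by simp
      fix a assume "a \<in> light_heights"
      then show "hausdorff_dim euclidean_metric (graph_of graph_fun \<inter> (UNIV \<times> {a})) =
          hausdorff_dim euclidean_metric (graph_of graph_fun) - 1"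
        using hausdorff_dim_slice[of a] hausdorff_dim_the_graph
        by (simp add: the_graph_def one_ereal_def)
    qed
  qed
qed

end
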